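(* Let $\phi=\tilde p/p$ be a rational inner function on $\mathbb{D}^2$ (as in the context) and let $i\in\{1,2\}$. Then for $1\le \mathfrak{p}<\infty$, $\frac{\partial\phi}{\partial z_i}\in H^{\mathfrak p}(\mathbb{D}^2)$ if and only if the $z_i$-contact order $K_i$ of $\phi$ satisfies $K_i<\frac{1}{\mathfrak p-1}$ (interpreted as $K_i<\infty$, i.e. always true, when $\mathfrak p=1$).
   Context: $\mathbb{D}^2$ is the open unit bidisk and $\mathbb{T}^2=(\partial\mathbb{D})^2$. A rational inner function of the form considered is $\phi=\tilde p/p$, where $p\in\mathbb{C}[z_1,z_2]$ has bidegree $(m,n)$, has no zeros in $\mathbb{D}^2$, is atoral (so it has finitely many zeros on $\mathbb{T}^2$, and $p,\tilde p$ have no common factor), and $\tilde p(z_1,z_2)=z_1^mz_2^n\overline{p(1/\bar z_1,1/\bar z_2)}$. Such $p$ has no zeros in $(\mathbb{D}\times\mathbb{T})\cup(\mathbb{T}\times\mathbb{D})$. A singularity of $\phi$ is a zero of $p$ on $\mathbb{T}^2$. For $0<\mathfrak p<\infty$, $H^{\mathfrak p}(\mathbb{D}^2)$ is the space of holomorphic $f$ on $\mathbb{D}^2$ with $\|f\|^{\mathfrak p}_{H^{\mathfrak p}}=\sup_{0<r<1}\frac{1}{4\pi^2}\int_{\mathbb{T}^2}|f(r\zeta)|^{\mathfrak p}|d\zeta|<\infty$. Contact order: for $\zeta_2\in\mathbb{T}$ which is not the $z_2$-coordinate of a singularity of $\phi$, set $\epsilon(\phi,\zeta_2)=\min\{1-|z_1|:\tilde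 p(z_1,\zeta_2)=0\}$ (the distance from the zeros of the degree-$m$ Blaschke product $\phi(\cdot,\zeta_2)$ to $\mathbb{T}$); set $\epsilon(\phi,\zeta_2)=0$ otherwise. For each $z_2$-coordinate $\tau_2$ of a singularity of $\phi$ there is a rational number $K>0$ (the $(z_1,\tau_2)$-contact order) such that $\epsilon(\phi,\zeta_2)\approx|\tau_2-\zeta_2|^K$ for $\zeta_2\in\mathbb{T}$ in a neighborhood of $\tau_2$ (here $A\approx B$ means $cB\le A\le CB$ for positive constants). The $z_1$-contact order $K_1$ of $\phi$ is the maximum of the $(z_1,\tau_2)$-contact orders over the finitely many such $\tau_2$, and $K_1=0$ if $\phi$ has no singularities. The $z_2$-contact order $K_2$ is defined analogously with the roles of the variables interchanged. *)

theory Defs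
  imports "HOL-Analysis.Analysis" "HOL-Computational_Algebra.Polynomial"
begin

text \<open>Bivariate polynomials p in C[z1,z2] are represented as complex poly poly:
  the outer variable is z1, the coefficients are polynomials in z2.\<close>

definition eval2 :: "complex poly poly \<Rightarrow> complex \<Rightarrow> complex \<Rightarrow> complex" where
  "eval2 p z1 z2 = poly (map_poly (\<lambda>a. poly a z2) p) z1"

definition deg1 :: "complex poly poly \<Rightarrow> nat" where
  "deg1 p = degree p"

definition deg2 :: "complex poly poly \<Rightarrow> nat" where
  "deg2 p = Max ((\<lambda>i. degree (coeff p i)) ` {..degree p})"

text \<open>Reflection: tilde p (z1,z2) = z1^m z2^n conj(p(1/conj z1, 1/conj z2)),
  written out on coefficients.\<close>
definition reflect2 :: "complex poly poly \<Rightarrow> complex poly poly" where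
  "reflect2 p = (\<Sum>i\<le>deg1 p. \<Sum>j\<le>deg2 p.
      monom (monom (cnj (coeff (coeff p (deg1 p - i)) (deg2 p - j))) j) i)"

definition sing :: "(complex \<Rightarrow> complex \<Rightarrow> complex) \<Rightarrow> (complex \<times> complex) set" where
  "sing P = {(a, b). norm a = 1 \<and> norm b = 1 \<and> P a b = 0}"

definition eps1 :: "(complex \<Rightarrow> complex \<Rightarrow> complex) \<Rightarrow> (complex \<Rightarrow> complex \<Rightarrow> complex)
    \<Rightarrow> complex \<Rightarrow> real" where
  "eps1 P Pt z2 = (if z2 \<in> snd ` sing P then 0
                   else Inf {1 - norm z1 | z1. Pt z1 z2 = 0})"

definition contact_at :: "(complex \<Rightarrow> complex \<Rightarrow> complex) \<Rightarrow> (complex \<Rightarrow> complex \<Rightarrow> complex)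
    \<Rightarrow> complex \<Rightarrow> real \<Rightarrow> bool" where
  "contact_at P Pt \<tau> K \<longleftrightarrow> 0 < K \<and>
     (\<exists>\<delta>>0. \<exists>c>0. \<exists>C>0. \<forall>\<zeta>. norm \<zeta> = 1 \<and> norm (\<zeta> - \<tau>) < \<delta> \<longrightarrow>
         c * norm (\<tau> - \<zeta>) powr K \<le> eps1 P Pt \<zeta> \<and> eps1 P Pt \<zeta> \<le> C * norm (\<tau> - \<zeta>) powr K)"

definition contact_order1 :: "(complex \<Rightarrow> complex \<Rightarrow> complex) \<Rightarrow> (complex \<Rightarrow> complex \<Rightarrow> complex)
    \<Rightarrow> real" where
  "contact_order1 P Pt = (if sing P = {} then 0
      else Max ((\<lambda>\<tau>. THE K. contact_at P Pt \<tau> K) ` (snd ` sing P)))"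

definition contact_order :: "nat \<Rightarrow> complex poly poly \<Rightarrow> real" where
  "contact_order i p = (if i = 1 then contact_order1 (eval2 p) (eval2 (reflect2 p))
      else contact_order1 (\<lambda>a b. eval2 p b a) (\<lambda>a b. eval2 (reflect2 p) b a))"

definition partial :: "nat \<Rightarrow> (complex \<Rightarrow> complex \<Rightarrow> complex) \<Rightarrow> complex \<Rightarrow> complex \<Rightarrow> complex" where
  "partial i f z1 z2 = (if i = 1 then deriv (\<lambda>w. f w z2) z1 else deriv (\<lambda>w. f z1 w) z2)"

text \<open>Holomorphic on the bidisk (separately holomorphic, equivalent by Hartogs).\<close>
definition holo_bidisk :: "(complex \<Rightarrow> complex \<Rightarrow> complex) \<Rightarrow> bool" where
  "holo_bidisk f \<longleftrightarrow> (\<forall>z2\<in>ball 0 1. (\<lambda>w. f w z2) holomorphic_on ball 0 1) \<and>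
                     (\<forall>z1\<in>ball 0 1. (\<lambda>w. f z1 w) holomorphic_on ball 0 1)"

definition hardy2 :: "real \<Rightarrow> (complex \<Rightarrow> complex \<Rightarrow> complex) \<Rightarrow> bool" where
  "hardy2 q f \<longleftrightarrow> holo_bidisk f \<and>
     (SUP r\<in>{0<..<1::real}. (\<integral>\<^sup>+ x. ennreal (norm (f (r * cis (fst x)) (r * cis (snd x))) powr q)
          * indicator ({0..2*pi} \<times> {0..2*pi}) x \<partial>lborel) / ennreal (4 * pi\<^sup>2)) < \<infinity>"

end

theory Submission
  imports Defs "HOL-Complex_Analysis.Complex_Analysis"
    "HOL-Computational_Algebra.Computational_Algebra" "HOL-Computational_Algebra.Field_as_Ring"
begin

text \<open>
  For \<open>\<zeta>\<close> on the circle away from the singularities, \<open>\<phi>(\<cdot>, \<zeta>)\<close> is a finite Blaschke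
  product with zeros \<open>\<alpha>\<^sub>1, \<dots>, \<alpha>\<^sub>m\<close>, and on the circle the modulus of its derivative is the sum of
  the Poisson kernels at the \<open>\<alpha>\<^sub>j\<close>. Each kernel has total mass \<open>2\<pi>\<close> and height comparable to
  \<open>1 / (1 - |\<alpha>\<^sub>j|)\<close>, so the \<open>q\<close>-th power of the derivative integrates to a quantity comparable
  to \<open>\<epsilon>(\<zeta>)\<close> to the power \<open>1 - q\<close>. Since \<open>\<epsilon>(\<zeta>)\<close> behaves like \<open>|\<zeta> - \<tau>|\<close> to the power \<open>K\<close>, the
  integral over \<open>\<zeta>\<close> converges near \<open>\<tau>\<close> iff \<open>K (q - 1) < 1\<close>.

  Contact orders exist without Puiseux series: the sum of \<open>1 / (1 - \<alpha>\<^sub>j cnj \<alpha>\<^sub>k)\<close> over all \<open>j, k\<close> has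
  modulus comparable to \<open>1 / \<epsilon>(\<zeta>)\<close>, since every term has positive real part. It equals the sum of
  \<open>m - \<alpha>\<^sub>j p'(\<alpha>\<^sub>j) / p(\<alpha>\<^sub>j)\<close> over \<open>j\<close>, a symmetric function of the roots of the reflected polynomial,
  and is therefore rational in \<open>\<zeta>\<close>.

  Membership in the Hardy space is passed to the boundary by Fatou's lemma in one direction, and by
  the monotonicity of integral means (Poisson formula and convexity), one variable at a time, in
  the other.
\<close>

section \<open>Bivariate polynomials\<close>

text \<open>Rationality of the root sum meets one obstacle: \<open>p\<close> has to be inverted at
  the roots of its reflection p~. Coprimality supplies a Bezout identity u p + v p~ = r with r a
  nonzero polynomial in z2 alone, so u / r replaces 1 / p at these roots. The same identity confines
  the z2-coordinates of singularities to the zeros of r. What is left is a polynomial summed over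
  the roots, which Newton's identities handle; their only denominator is the leading coefficient of
  p~ in z1, and it does not vanish on the circle.

  The two variables are treated differently as r tends to 1. Zeros of \<open>p\<close> on the torus
  stand in the way of a joint passage to the boundary, but \<open>p\<close> has no zeros on the
  product of the open disk with the closed disk. For the upper bound z2 alone is moved to the circle
  while |z1| = r stays below 1, and the slice estimate at that radius is uniform in r.

  Only comparability with a rational function enters, so a contact order arises as the difference of
  two vanishing orders.\<close>

lemma poly_eq_sum_le:
  fixes x :: "'a :: comm_semiring_1"
  assumes "degree p \<le> n"
  shows "poly p x = (\<Sum>i\<le>n. coeff p i * x ^ i)"
  by (subst poly_as_sum_of_monoms'[OF assms, symmetric]) (simp add: poly_sum poly_monom)

text \<open>Evaluation at the constant polynomial z1 and then at z2 composes two ring homomorphisms,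
  which makes additivity and multiplicativity immediate.\<close>

lemma eval2_altdef: "eval2 p z1 z2 = poly (poly p [:z1:]) z2"
  unfolding eval2_def by (induction p) (simp_all add: map_poly_pCons)

lemma eval2_add [simp]: "eval2 (p + q) a b = eval2 p a b + eval2 q a b"
  and eval2_mult [simp]: "eval2 (p * q) a b = eval2 p a b * eval2 q a b"
  and eval2_0 [simp]: "eval2 0 a b = 0"
  and eval2_const [simp]: "eval2 [:c:] a b = poly c b"
  and eval2_monom: "eval2 (monom (monom k j) i) a b = k * a ^ i * b ^ j"
  by (simp_all add: eval2_altdef poly_monom)

lemma eval2_sum: "eval2 (sum f A) a b = (\<Sum>x\<in>A. eval2 (f x) a b)"
  by (induction A rule: infinite_finite_induct) auto

lemma eval2_eqI:
  assumes "\<And>a b. eval2 p a b = eval2 q a b"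
  shows "p = q"
proof (rule poly_eqI)
  fix i
  have "map_poly (\<lambda>a. poly a b) p = map_poly (\<lambda>a. poly a b) q" for b
    using assms[of _ b] by (intro poly_ext) (simp add: eval2_def)
  then have "poly (coeff p i) b = poly (coeff q i) b" for b
    by (metis coeff_map_poly poly_0)
  then show "coeff p i = coeff q i"
    by (intro poly_ext)
qed

text \<open>Freezing z2 may lower the degree, so later statements carry the formal degree
  \<open>deg1 p\<close> instead of the degree of the slice.\<close>

definition slice :: "complex poly poly \<Rightarrow> complex \<Rightarrow> complex poly" where
  "slice p b = map_poly (\<lambda>a. poly a b) p"

lemma poly_slice: "poly (slice p b) a = eval2 p a b"
  by (simp add: slice_def eval2_def)

lemma coeff_slice [simp]: "coeff (slice p b) i = poly (coeff p i) b"
  by (simp add: slice_def coeff_map_poly)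

lemma degree_slice_le: "degree (slice p b) \<le> degree p"
  by (rule degree_le) (simp add: coeff_eq_0)

text \<open>The divisor is z2 - b, seen as constant in z1. In this form a vanishing slice can be
  played against coprimality.\<close>

lemma slice_eq_0_imp_dvd:
  assumes "slice p b = 0"
  shows "[:[:-b, 1:]:] dvd p"
  unfolding const_poly_dvd_iff
  by (metis assms coeff_0 coeff_slice poly_eq_0_iff_dvd)

lemma degree_coeff_le_deg2: "degree (coeff p i) \<le> deg2 p"
proof (cases "i \<le> degree p")
  case True
  then show ?thesis unfolding deg2_def by (intro Max_ge) auto
qed (simp add: coeff_eq_0)

lemma eval2_as_sum:
  "eval2 p a b = (\<Sum>i\<le>deg1 p. \<Sum>j\<le>deg2 p. coeff (coeff p i) j * a ^ i * b ^ j)"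
proof -
  have 1: "poly (coeff p i) b = (\<Sum>j\<le>deg2 p. coeff (coeff p i) j * b ^ j)" for i
    by (rule poly_eq_sum_le) (rule degree_coeff_le_deg2)
  have "eval2 p a b = (\<Sum>i\<le>deg1 p. poly (coeff p i) b * a ^ i)"
    unfolding poly_slice[symmetric] coeff_slice[symmetric]
    by (rule poly_eq_sum_le) (simp add: deg1_def degree_slice_le)
  then show ?thesis by (simp add: 1 sum_distrib_right sum_distrib_left mult_ac)
qed

lemma coeff_coeff_reflect2:
  assumes "i \<le> deg1 p" "j \<le> deg2 p"
  shows "coeff (coeff (reflect2 p) i) j = cnj (coeff (coeff p (deg1 p - i)) (deg2 p - j))"
proof -
  have "coeff (coeff (reflect2 p) i) j = (\<Sum>i'\<le>deg1 p. \<Sum>j'\<le>deg2 p.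
      if i' = i then (if j' = j then cnj (coeff (coeff p (deg1 p - i')) (deg2 p - j')) else 0) else 0)"
    unfolding reflect2_def coeff_sum
    by (intro sum.cong) (auto simp: coeff_monom)
  also have "\<dots> = cnj (coeff (coeff p (deg1 p - i)) (deg2 p - j))"
  proof -
    have "(\<Sum>j'\<le>deg2 p.
      if i' = i then (if j' = j then cnj (coeff (coeff p (deg1 p - i')) (deg2 p - j')) else 0) else 0)
      = (if i' = i then cnj (coeff (coeff p (deg1 p - i')) (deg2 p - j)) else 0)" for i'
      using assms by (simp add: sum.delta)
    then show ?thesis using assms by (simp add: sum.delta)
  qed
  finally show ?thesis .
qed

lemma coeff_reflect2_beyond:
  assumes "i > deg1 p" shows "coeff (reflect2 p) i = 0"
  unfolding reflect2_def coeff_sum using assms by (intro sum.neutral ballI) (auto simp: coeff_monom)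

lemma degree_reflect2_le: "degree (reflect2 p) \<le> deg1 p"
  by (rule degree_le) (simp add: coeff_reflect2_beyond)

lemma degree_coeff_reflect2_le: "degree (coeff (reflect2 p) i) \<le> deg2 p"
  unfolding reflect2_def coeff_sum
  by (intro degree_sum_le degree_le) (auto simp: coeff_monom)

text \<open>On the circle b^(n-j) = b^n * cnj b^j. Up to the unimodular factor b^n, slicing the
  reflection is therefore one-variable reflection of the slice, with formal degree
  \<open>deg1 p\<close>.\<close>

lemma coeff_slice_reflect2:
  assumes "norm b = 1" "i \<le> deg1 p"
  shows "coeff (slice (reflect2 p) b) i = b ^ deg2 p * cnj (coeff (slice p b) (deg1 p - i))"
proof -
  have b: "b * cnj b = 1" using assms(1) by (simp add: complex_norm_square[symmetric])
  have pw: "b ^ (N - j) = b ^ N * cnj b ^ j" if "j \<le> N" for j N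
  proof -
    have "b ^ N * cnj b ^ j = b ^ (N - j) * (b * cnj b) ^ j"
      using that by (simp add: power_mult_distrib power_add[symmetric] mult.assoc[symmetric])
    then show ?thesis by (simp add: b)
  qed
  have "coeff (slice (reflect2 p) b) i = (\<Sum>j\<le>deg2 p. coeff (coeff (reflect2 p) i) j * b ^ j)"
    by (simp only: coeff_slice, rule poly_eq_sum_le, rule degree_coeff_reflect2_le)
  also have "\<dots> = (\<Sum>j\<le>deg2 p. cnj (coeff (coeff p (deg1 p - i)) (deg2 p - j)) * b ^ j)"
    by (intro sum.cong) (auto simp: coeff_coeff_reflect2 assms)
  also have "\<dots> = (\<Sum>j\<le>deg2 p. cnj (coeff (coeff p (deg1 p - i)) j) * b ^ (deg2 p - j))"
    by (rule sum.reindex_bij_witness[of _ "\<lambda>j. deg2 p - j" "\<lambda>j. deg2 p - j"]) auto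
  also have "\<dots> = (\<Sum>j\<le>deg2 p. cnj (coeff (coeff p (deg1 p - i)) j) * (b ^ deg2 p * cnj b ^ j))"
    by (intro sum.cong) (auto simp: pw)
  also have "\<dots> = b ^ deg2 p * cnj (\<Sum>j\<le>deg2 p. coeff (coeff p (deg1 p - i)) j * b ^ j)"
    by (simp add: sum_distrib_left mult_ac)
  also have "(\<Sum>j\<le>deg2 p. coeff (coeff p (deg1 p - i)) j * b ^ j) = poly (coeff p (deg1 p - i)) b"
    by (rule poly_eq_sum_le[symmetric]) (rule degree_coeff_le_deg2)
  finally show ?thesis by simp
qed

section \<open>Interchange of the two variables\<close>

definition swap2 :: "complex poly poly \<Rightarrow> complex poly poly" where
  "swap2 p = (\<Sum>i\<le>deg1 p. \<Sum>j\<le>deg2 p. monom (monom (coeff (coeff p i) j) i) j)"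

lemma eval2_swap2 [simp]: "eval2 (swap2 p) a b = eval2 p b a"
  unfolding swap2_def eval2_sum eval2_monom by (simp add: eval2_as_sum mult_ac)

lemma swap2_swap2 [simp]: "swap2 (swap2 p) = p"
  by (rule eval2_eqI) simp

lemma swap2_mult: "swap2 (p * q) = swap2 p * swap2 q"
  by (rule eval2_eqI) simp

lemma swap2_1 [simp]: "swap2 1 = 1"
  by (rule eval2_eqI) (simp add: one_pCons)

lemma swap2_dvd: "p dvd q \<Longrightarrow> swap2 p dvd swap2 q"
  by (auto simp: dvd_def swap2_mult)

lemma coprime_swap2:
  assumes "coprime p q" shows "coprime (swap2 p) (swap2 q)"
proof (rule coprimeI)
  fix c assume "c dvd swap2 p" "c dvd swap2 q"
  then have "swap2 c dvd p" "swap2 c dvd q" using swap2_dvd[of c] by (metis swap2_swap2)+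
  then have "swap2 c dvd 1" using assms coprime_common_divisor by blast
  then show "c dvd 1" using swap2_dvd[of "swap2 c" 1] by simp
qed

lemma coeff_coeff_swap2: "coeff (coeff (swap2 p) i) j = coeff (coeff p j) i"
proof -
  have "coeff (coeff (swap2 p) i) j = (\<Sum>i'\<le>deg1 p. \<Sum>j'\<le>deg2 p.
      if i' = j then (if j' = i then coeff (coeff p i') j' else 0) else 0)"
    unfolding swap2_def coeff_sum
    by (intro sum.cong) (auto simp: coeff_monom)
  also have "\<dots> = (\<Sum>i'\<le>deg1 p. if i' = j then coeff (coeff p j) i else 0)"
  proof (intro sum.cong refl)
    fix i'
    show "(\<Sum>j'\<le>deg2 p. if i' = j then (if j' = i then coeff (coeff p i') j' else 0) else 0)
      = (if i' = j then coeff (coeff p j) i else 0)"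
      using degree_coeff_le_deg2[of p j] by (auto simp: sum.delta coeff_eq_0)
  qed
  also have "\<dots> = coeff (coeff p j) i"
    by (auto simp: sum.delta coeff_eq_0 deg1_def)
  finally show ?thesis .
qed

lemma deg1_swap2: "deg1 (swap2 p) = deg2 p"
proof (rule antisym)
  show "deg1 (swap2 p) \<le> deg2 p" unfolding deg1_def
  proof (rule degree_le, intro allI impI poly_eqI)
    fix i j assume "deg2 p < i"
    then show "coeff (coeff (swap2 p) i) j = coeff 0 j"
      using degree_coeff_le_deg2[of p j] by (simp add: coeff_coeff_swap2 coeff_eq_0)
  qed
  have "deg2 p \<in> (\<lambda>i. degree (coeff p i)) ` {..degree p}"
    unfolding deg2_def by (rule Max_in) auto
  then obtain i where i: "deg2 p = degree (coeff p i)" by auto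
  show "deg2 p \<le> deg1 (swap2 p)"
  proof (cases "coeff p i = 0")
    case False
    then have "coeff (coeff (swap2 p) (deg2 p)) i \<noteq> 0"
      by (simp add: coeff_coeff_swap2 i)
    then show ?thesis unfolding deg1_def by (intro le_degree) auto
  qed (use i in simp)
qed

lemma deg2_swap2: "deg2 (swap2 p) = deg1 p"
  using deg1_swap2[of "swap2 p"] by simp

text \<open>Reflection depends on the bidegree, so this rests on \<open>swap2\<close> exchanging
  \<open>deg1\<close> and \<open>deg2\<close> exactly.\<close>

lemma reflect2_swap2: "reflect2 (swap2 p) = swap2 (reflect2 p)"
proof (rule eval2_eqI)
  fix a b
  show "eval2 (reflect2 (swap2 p)) a b = eval2 (swap2 (reflect2 p)) a b"
    unfolding eval2_swap2 unfolding reflect2_def deg1_swap2 deg2_swap2 eval2_sum eval2_monom coeff_coeff_swap2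
    by (subst sum.swap) (simp add: mult_ac)
qed

section \<open>A Bezout identity with right-hand side free of z1\<close>

text \<open>C[z2][z1] is not a principal ideal domain. Instead, d is a nonzero element of least
  z1-degree in the ideal of \<open>p\<close> and \<open>q\<close>; its primitive part divides the
  whole ideal, hence is a unit, and so d is constant in z1.\<close>

lemma coprime_bezout_const:
  fixes p q :: "complex poly poly"
  assumes "coprime p q"
  obtains a b r where "r \<noteq> 0" "a * p + b * q = [:r:]"
proof -
  define J where "J = {d. d \<noteq> 0 \<and> (\<exists>a b. d = a * p + b * q)}"
  have "p \<noteq> 0 \<or> q \<noteq> 0" using assms by auto
  then have "p \<in> J \<or> q \<in> J" unfolding J_def
    by (metis (mono_tags, lifting) add.right_neutral add_0 mem_Collect_eq mult_1 mult_zero_left)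
  then obtain d where d: "d \<in> J" and min: "\<And>e. e \<in> J \<Longrightarrow> degree d \<le> degree e"
    using ex_has_least_nat[of "\<lambda>d. d \<in> J" _ degree] by blast
  from d obtain a b where ab: "d = a * p + b * q" and "d \<noteq> 0" by (auto simp: J_def)
  have div: "primitive_part d dvd f" if f: "\<exists>u v. f = u * p + v * q" for f
  proof -
    obtain u v where uv: "f = u * p + v * q" using f by blast
    obtain c s where c: "c \<noteq> 0" "smult c f = d * s + pseudo_mod f d"
      using pseudo_mod(1)[OF \<open>d \<noteq> 0\<close>, of f] by blast
    \<comment> \<open>The pseudo-remainder stays in the ideal and, unless zero, has smaller degree
      than d; minimality makes it zero.\<close>
    have "pseudo_mod f d = (smult c u - a * s) * p + (smult c v - b * s) * q"
      using c(2) by (simp add: ab uv algebra_simps smult_add_right)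
    then have "pseudo_mod f d = 0"
      using min[of "pseudo_mod f d"] pseudo_mod(2)[OF \<open>d \<noteq> 0\<close>, of f] unfolding J_def by fastforce
    then have "smult c f = d * s" using c by simp
    also have "d = smult (content d) (primitive_part d)" by simp
    finally have "smult c f = primitive_part d * smult (content d) s"
      by (metis mult_smult_left mult_smult_right)
    \<comment> \<open>Over the fraction field the multiplier c of the pseudo-division is a unit.
      Gauss's lemma brings the divisibility back, because the divisor is primitive.\<close>
    then have "fract_poly (smult c f) = fract_poly (primitive_part d) * fract_poly (smult (content d) s)"
      by (metis fract_poly_mult)
    then have "fract_poly (primitive_part d) dvd smult (to_fract c) (fract_poly f)"
      by (metis dvd_triv_left fract_poly_smult)
    then have "fract_poly (primitive_part d) dvd fract_poly f"
      using c(1) by (simp add: dvd_smult_iff)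
    then show ?thesis using \<open>d \<noteq> 0\<close> by (intro fract_poly_dvdD) simp_all
  qed
  have "primitive_part d dvd p" "primitive_part d dvd q"
    by (rule div, metis add.right_neutral mult_1 mult_zero_left) (rule div, metis add_0 mult_1 mult_zero_left)
  then have "is_unit (primitive_part d)" using assms coprime_common_divisor by blast
  then have "degree (primitive_part d) = 0" using is_unit_poly_iff by (metis degree_pCons_0)
  then have "degree d = 0" by simp
  then obtain r where "d = [:r:]" by (rule degree_eq_zeroE)
  with \<open>d \<noteq> 0\<close> ab show ?thesis using that[of r a b] by (metis pCons_0_0)
qed

section \<open>Polynomials without zeros in the disk\<close>

lemma poly_prod_list: "poly (prod_list fs) x = (\<Prod>f\<leftarrow>fs. poly f x)"
  by (induction fs) auto

lemma complex_poly_factor_list: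
  fixes f :: "complex poly"
  assumes "f \<noteq> 0"
  obtains as where "length as = degree f" "f = smult (lead_coeff f) (\<Prod>x\<leftarrow>as. [:-x, 1:])"
proof -
  obtain A where A: "size A = degree f" "f = smult (lead_coeff f) (\<Prod>x\<in>#A. [:-x, 1:])"
    using alg_closed_imp_factorization[OF assms] by blast
  obtain as where "mset as = A" using ex_mset by blast
  with A show ?thesis
    by (intro that[of as]) (auto simp: prod_mset_prod_list[symmetric] simp flip: size_mset mset_map)
qed

text \<open>For |x| >= 1 the distance |a - x| is at least 1 - |a|, so the 2 in |c - x| <= 2 + |a -
  x| is at most 2 / (1 - |a|) times |a - x|. The resulting factor involves neither x nor c.\<close>

lemma norm_prod_list_diff_le:
  fixes a c :: complex
  assumes "norm a < 1" "norm c < 1" "\<forall>x\<in>set as. 1 \<le> norm x"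
  shows "norm (\<Prod>x\<leftarrow>as. c - x) \<le> (1 + 2 / (1 - norm a)) ^ length as * norm (\<Prod>x\<leftarrow>as. a - x)"
  using assms(3)
proof (induction as)
  case (Cons x as)
  let ?C = "1 + 2 / (1 - norm a)"
  have C: "?C \<ge> 0" using assms by simp
  have d: "1 - norm a \<le> norm (a - x)"
    using Cons.prems norm_triangle_ineq2[of x a] by (simp add: norm_minus_commute)
  have "norm (c - x) \<le> norm (c - a) + norm (a - x)" by norm
  also have "norm (c - a) \<le> 2" using norm_triangle_ineq4[of c a] assms by linarith
  also have "2 \<le> 2 / (1 - norm a) * norm (a - x)"
    using d assms by (simp add: pos_le_divide_eq)
  finally have "norm (c - x) \<le> ?C * norm (a - x)" by (simp add: algebra_simps)
  then have "norm (c - x) * norm (\<Prod>x\<leftarrow>as. c - x)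
      \<le> (?C * norm (a - x)) * (?C ^ length as * norm (\<Prod>x\<leftarrow>as. a - x))"
    using Cons C by (intro mult_mono) auto
  then show ?case by (simp add: norm_mult mult_ac)
qed simp

text \<open>A Harnack inequality: it transports the absence of zeros in the disk to limits.\<close>

lemma norm_poly_le_of_no_zeros_in_disk:
  fixes f :: "complex poly"
  assumes "\<And>z. norm z < 1 \<Longrightarrow> poly f z \<noteq> 0" "degree f \<le> m" "norm a < 1" "norm c < 1"
  shows "norm (poly f c) \<le> (1 + 2 / (1 - norm a)) ^ m * norm (poly f a)"
proof -
  let ?C = "1 + 2 / (1 - norm a)"
  have "f \<noteq> 0" using assms(1)[of 0] by auto
  then obtain as where as: "length as = degree f" "f = smult (lead_coeff f) (\<Prod>x\<leftarrow>as. [:-x, 1:])"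
    by (rule complex_poly_factor_list)
  have ev: "poly f z = lead_coeff f * (\<Prod>x\<leftarrow>as. z - x)" for z
    by (subst as(2)) (simp add: poly_prod_list o_def)
  have "1 \<le> norm x" if "x \<in> set as" for x
  proof (rule ccontr)
    assume "\<not> 1 \<le> norm x"
    moreover have "poly f x = 0"
      using that by (auto simp: ev prod_list_zero_iff)
    ultimately show False using assms(1) by force
  qed
  then have "norm (\<Prod>x\<leftarrow>as. c - x) \<le> ?C ^ degree f * norm (\<Prod>x\<leftarrow>as. a - x)"
    using norm_prod_list_diff_le[OF assms(3,4), of as] as(1) by simp
  also have "\<dots> \<le> ?C ^ m * norm (\<Prod>x\<leftarrow>as. a - x)"
    using assms by (intro mult_right_mono power_increasing) auto
  finally have "norm (lead_coeff f) * norm (\<Prod>x\<leftarrow>as. c - x) \<le> norm (lead_coeff f) * (?C ^ m * norm (\<Prod>x\<leftarrow>as. a - x))"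
    by (intro mult_left_mono) auto
  then show ?thesis by (simp add: ev norm_mult algebra_simps)
qed

lemma continuous_on_eval2 [continuous_intros]:
  assumes "continuous_on S f" "continuous_on S g"
  shows "continuous_on S (\<lambda>x. eval2 p (f x) (g x))"
  unfolding eval2_as_sum using assms by (intro continuous_intros)

lemma slice_pderiv: "slice (pderiv p) b = pderiv (slice p b)"
  by (rule poly_eqI) (simp add: coeff_pderiv)

lemma has_field_derivative_eval2:
  "((\<lambda>w. eval2 p w b) has_field_derivative eval2 (pderiv p) a b) (at a)"
  unfolding poly_slice[symmetric] slice_pderiv by (rule poly_DERIV)

section \<open>Blaschke products\<close>

text \<open>The list records multiplicities. The unimodular constant of a general Blaschke product
  is left out; it returns as \<open>u\<close> in \<open>F_blaschke\<close>.\<close>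

definition blaschke :: "complex list \<Rightarrow> complex \<Rightarrow> complex" where
  "blaschke as z = (\<Prod>a\<leftarrow>as. (z - a) / (1 - cnj a * z))"

lemma one_minus_cnj_mult_neq_0:
  assumes "norm a < 1" "norm z \<le> 1"
  shows "1 - cnj a * z \<noteq> 0"
proof
  assume "1 - cnj a * z = 0"
  then have "norm (cnj a * z) = 1" by (metis eq_iff_diff_eq_0 norm_one)
  moreover have "norm (cnj a * z) \<le> norm a" using assms
    by (simp add: norm_mult mult_left_le)
  ultimately show False using assms by simp
qed

lemma norm_one_minus_cnj_mult:
  assumes "norm z = 1" shows "norm (1 - cnj a * z) = norm (z - a)"
proof -
  have "z * cnj z = 1" using assms by (simp add: complex_norm_square[symmetric])
  then have "1 - cnj a * z = z * cnj (z - a)" by (simp add: algebra_simps)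
  then show ?thesis using assms by (simp only: norm_mult complex_mod_cnj mult_1)
qed

lemma blaschke_factor_identity:
  "(norm (1 - cnj a * z))\<^sup>2 - (norm (z - a))\<^sup>2 = (1 - (norm a)\<^sup>2) * (1 - (norm z)\<^sup>2)"
proof -
  have "complex_of_real ((norm (1 - cnj a * z))\<^sup>2 - (norm (z - a))\<^sup>2)
      = complex_of_real ((1 - (norm a)\<^sup>2) * (1 - (norm z)\<^sup>2))"
    by (simp only: of_real_diff of_real_mult of_real_1 complex_norm_square) (simp add: algebra_simps)
  then show ?thesis using of_real_eq_iff by blast
qed

lemma norm_blaschke_factor_le_1:
  assumes "norm a < 1" "norm z \<le> 1"
  shows "norm ((z - a) / (1 - cnj a * z)) \<le> 1"
proof -
  have "0 \<le> (1 - (norm a)\<^sup>2) * (1 - (norm z)\<^sup>2)"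
    using assms by (intro mult_nonneg_nonneg) (auto simp: power_le_one)
  then have "norm (z - a) \<le> norm (1 - cnj a * z)"
    using blaschke_factor_identity[of a z] by (intro power2_le_imp_le[OF _ norm_ge_zero]) linarith
  then show ?thesis using one_minus_cnj_mult_neq_0[OF assms] by (simp add: norm_divide)
qed

lemma has_field_derivative_blaschke_factor:
  assumes "1 - cnj a * z \<noteq> 0"
  shows "((\<lambda>z. (z - a) / (1 - cnj a * z)) has_field_derivative
            of_real (1 - (norm a)\<^sup>2) / (1 - cnj a * z)\<^sup>2) (at z)"
proof -
  have "complex_of_real (1 - (norm a)\<^sup>2) = 1 - a * cnj a"
    by (simp only: of_real_diff of_real_1 complex_norm_square)
  then show ?thesis using assms
    by (auto intro!: derivative_eq_intros simp: power2_eq_square field_simps)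
qed

text \<open>The facts are bundled because the product rule consumes all of them in the induction.
  Inside the disk only a triangle inequality is available; on the circle z B' / B is a sum of
  nonnegative reals, so there is no cancellation and the modulus of the derivative is exact.\<close>

lemma blaschke_derivative:
  assumes "\<forall>a\<in>set as. norm a < 1" "norm z \<le> 1"
  shows "\<exists>D. (blaschke as has_field_derivative D) (at z) \<and> norm (blaschke as z) \<le> 1 \<and>
    norm D \<le> (\<Sum>a\<leftarrow>as. (1 - (norm a)\<^sup>2) / (norm (1 - cnj a * z))\<^sup>2) \<and>
    (norm z = 1 \<longrightarrow> norm (blaschke as z) = 1 \<and>
     z * D = blaschke as z * of_real (\<Sum>a\<leftarrow>as. (1 - (norm a)\<^sup>2) / (norm (z - a))\<^sup>2))"
  using assms(1)
proof (induction as)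
  case Nil
  show ?case by (rule exI[of _ 0]) (auto simp: blaschke_def[abs_def])
next
  case (Cons a as)
  then obtain D where D: "(blaschke as has_field_derivative D) (at z)" "norm (blaschke as z) \<le> 1"
    "norm D \<le> (\<Sum>a\<leftarrow>as. (1 - (norm a)\<^sup>2) / (norm (1 - cnj a * z))\<^sup>2)"
    "norm z = 1 \<Longrightarrow> norm (blaschke as z) = 1"
    "norm z = 1 \<Longrightarrow> z * D = blaschke as z * of_real (\<Sum>a\<leftarrow>as. (1 - (norm a)\<^sup>2) / (norm (z - a))\<^sup>2)"
    by auto
  have a: "norm a < 1" using Cons.prems by simp
  have ne: "1 - cnj a * z \<noteq> 0" by (rule one_minus_cnj_mult_neq_0[OF a assms(2)])
  define \<beta> where "\<beta> = (z - a) / (1 - cnj a * z)"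
  define \<beta>' where "\<beta>' = of_real (1 - (norm a)\<^sup>2) / (1 - cnj a * z)\<^sup>2"
  have eq: "blaschke (a # as) = (\<lambda>z. (z - a) / (1 - cnj a * z) * blaschke as z)"
    by (auto simp: blaschke_def)
  have d: "(blaschke (a # as) has_field_derivative (\<beta>' * blaschke as z + D * \<beta>)) (at z)"
    unfolding eq \<beta>_def \<beta>'_def
    by (rule DERIV_mult[OF has_field_derivative_blaschke_factor[OF ne] D(1)])
  have b1: "norm \<beta> \<le> 1" unfolding \<beta>_def by (rule norm_blaschke_factor_le_1[OF a assms(2)])
  have nn: "0 \<le> 1 - (norm a)\<^sup>2" using a by (simp add: power_le_one)
  have b': "norm \<beta>' = (1 - (norm a)\<^sup>2) / (norm (1 - cnj a * z))\<^sup>2"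
    unfolding \<beta>'_def norm_divide norm_power norm_of_real using nn by simp
  have val: "blaschke (a # as) z = \<beta> * blaschke as z" by (simp add: eq \<beta>_def)
  have n1: "norm (blaschke (a # as) z) \<le> 1"
    unfolding val norm_mult using b1 D(2) by (simp add: mult_le_one)
  have "norm (\<beta>' * blaschke as z + D * \<beta>) \<le> norm \<beta>' * norm (blaschke as z) + norm D * norm \<beta>"
    by (metis norm_mult norm_triangle_ineq)
  also have "\<dots> \<le> norm \<beta>' * 1 + norm D * 1"
    using b1 D(2) by (intro add_mono mult_left_mono) auto
  finally have n2: "norm (\<beta>' * blaschke as z + D * \<beta>) \<le> (\<Sum>a\<leftarrow>a # as. (1 - (norm a)\<^sup>2) / (norm (1 - cnj a * z))\<^sup>2)"
    using D(3) b' by simp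
  have t: "norm (blaschke (a # as) z) = 1 \<and> z * (\<beta>' * blaschke as z + D * \<beta>) =
      blaschke (a # as) z * of_real (\<Sum>a\<leftarrow>a # as. (1 - (norm a)\<^sup>2) / (norm (z - a))\<^sup>2)"
    if z: "norm z = 1"
  proof
    have nz: "norm (1 - cnj a * z) = norm (z - a)" by (rule norm_one_minus_cnj_mult[OF z])
    then have "z - a \<noteq> 0" using ne by auto
    then have "norm \<beta> = 1" using nz by (simp add: \<beta>_def norm_divide)
    then show "norm (blaschke (a # as) z) = 1" using D(4)[OF z] by (simp add: val norm_mult)
    have zz: "z * cnj z = 1" using z by (simp add: complex_norm_square[symmetric])
    have n: "complex_of_real ((norm (z - a))\<^sup>2) = (z - a) * cnj (z - a)" by (rule complex_norm_square)
    have e: "1 - cnj a * z = z * cnj (z - a)" using zz by (simp add: algebra_simps)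
    have "z \<noteq> 0" using z by auto
    \<comment> \<open>Here w = z - a and w' is its conjugate, so that 1 - cnj a * z = z * w' and |z
      - a|^2 = w * w'. The identity holds for independent w and w'.\<close>
    have gen: "z * (k / (z * w')\<^sup>2) = w / (z * w') * (k / (w * w'))" if "w \<noteq> 0" "w' \<noteq> 0" for k w w'
      using that \<open>z \<noteq> 0\<close> by (simp add: field_simps power2_eq_square)
    have zb: "z * \<beta>' = \<beta> * of_real ((1 - (norm a)\<^sup>2) / (norm (z - a))\<^sup>2)"
      unfolding \<beta>'_def \<beta>_def of_real_divide n e using \<open>z - a \<noteq> 0\<close>
      by (intro gen) (auto simp del: complex_cnj_diff)
    have "z * (\<beta>' * blaschke as z + D * \<beta>) = (z * \<beta>') * blaschke as z + (z * D) * \<beta>"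
      by (simp add: algebra_simps)
    also note zb
    also note D(5)[OF z]
    finally show "z * (\<beta>' * blaschke as z + D * \<beta>) =
      blaschke (a # as) z * of_real (\<Sum>a\<leftarrow>a # as. (1 - (norm a)\<^sup>2) / (norm (z - a))\<^sup>2)"
      unfolding val by (simp add: algebra_simps)
  qed
  show ?case using d n1 n2 t by blast
qed

section \<open>Power sums\<close>

text \<open>Since 1 / (1 - c z) = 1 + c z / (1 - c z), the sum is the number of factors minus z q' /
  q, where q is the product; the statement is multiplied through by q.\<close>

lemma logderiv_prod_one_minus:
  fixes z :: complex
  assumes "\<forall>c\<in>set cs. 1 - c * z \<noteq> 0"
  shows "poly (\<Prod>c\<leftarrow>cs. [:1, -c:]) z * (\<Sum>c\<leftarrow>cs. 1 / (1 - c * z))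
    = of_nat (length cs) * poly (\<Prod>c\<leftarrow>cs. [:1, -c:]) z - z * poly (pderiv (\<Prod>c\<leftarrow>cs. [:1, -c:])) z"
  using assms
proof (induction cs)
  case (Cons c cs)
  let ?q = "\<Prod>c\<leftarrow>cs. [:1, -c:]"
  have "1 - c * z \<noteq> 0" using Cons by simp
  have "poly (\<Prod>c\<leftarrow>c # cs. [:1, -c:]) z * (\<Sum>c\<leftarrow>c # cs. 1 / (1 - c * z))
      = (1 - c * z) * (poly ?q z * (\<Sum>c\<leftarrow>cs. 1 / (1 - c * z))) + poly ?q z"
    using \<open>1 - c * z \<noteq> 0\<close> by (simp add: field_simps)
  also have "poly ?q z * (\<Sum>c\<leftarrow>cs. 1 / (1 - c * z))
    = of_nat (length cs) * poly ?q z - z * poly (pderiv ?q) z"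
    using Cons by simp
  also have "(1 - c * z) * (of_nat (length cs) * poly ?q z - z * poly (pderiv ?q) z) + poly ?q z
    = of_nat (length (c # cs)) * poly (\<Prod>c\<leftarrow>c # cs. [:1, -c:]) z
      - z * poly (pderiv (\<Prod>c\<leftarrow>c # cs. [:1, -c:])) z"
    by (simp add: pderiv_mult pderiv_pCons algebra_simps del: mult_pCons_left)
  finally show ?case .
qed simp

lemma fps_geometric_mult: "(1 - fps_const c * fps_X) * Abs_fps (\<lambda>k. c ^ k) = (1 :: complex fps)"
proof (rule fps_ext)
  fix n show "fps_nth ((1 - fps_const c * fps_X) * Abs_fps (\<lambda>k. c ^ k)) n = fps_nth 1 n"
    by (cases n) (simp_all add: left_diff_distrib mult.assoc)
qed

text \<open>The logarithmic derivative identity again, now for formal power series: 1 / (1 - c X) is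
  the geometric series in c X, so the sum over c generates the power sums.\<close>

lemma fps_power_sums:
  fixes cs :: "complex list"
  defines "Q \<equiv> \<lambda>cs. \<Prod>c\<leftarrow>cs. 1 - fps_const c * fps_X"
  shows "Q cs * Abs_fps (\<lambda>k. \<Sum>c\<leftarrow>cs. c ^ k) = of_nat (length cs) * Q cs - fps_X * fps_deriv (Q cs)"
proof (induction cs)
  case Nil
  then show ?case by (simp add: Q_def fps_zero_def[symmetric])
next
  case (Cons c cs)
  have S: "Abs_fps (\<lambda>k. \<Sum>c\<leftarrow>c # cs. c ^ k) = Abs_fps (\<lambda>k. c ^ k) + Abs_fps (\<lambda>k. \<Sum>c\<leftarrow>cs. c ^ k)"
    by (rule fps_ext) simp
  have Q: "Q (c # cs) = (1 - fps_const c * fps_X) * Q cs" by (simp add: Q_def)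
  have "Q (c # cs) * Abs_fps (\<lambda>k. \<Sum>c\<leftarrow>c # cs. c ^ k) =
      ((1 - fps_const c * fps_X) * Abs_fps (\<lambda>k. c ^ k)) * Q cs
      + (1 - fps_const c * fps_X) * (Q cs * Abs_fps (\<lambda>k. \<Sum>c\<leftarrow>cs. c ^ k))"
    unfolding S Q by (simp only: algebra_simps)
  also have "\<dots> = Q cs + (1 - fps_const c * fps_X) * (of_nat (length cs) * Q cs - fps_X * fps_deriv (Q cs))"
    unfolding fps_geometric_mult Cons.IH by simp
  also have "\<dots> = of_nat (length (c # cs)) * Q (c # cs) - fps_X * fps_deriv (Q (c # cs))"
    unfolding Q by (simp add: algebra_simps)
  finally show ?case .
qed

text \<open>Comparison of coefficients of X^k. The coefficients of q are the signed elementary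
  symmetric functions, and the term i = k contributes \<open>length cs\<close> times
  \<open>coeff q k\<close>, which explains the factor on the right.\<close>

lemma newton_identity:
  fixes cs :: "complex list"
  defines "q \<equiv> \<Prod>c\<leftarrow>cs. [:1, -c:]"
  shows "(\<Sum>i\<le>k. coeff q i * (\<Sum>c\<leftarrow>cs. c ^ (k - i))) = (of_nat (length cs) - of_nat k) * coeff q k"
proof -
  have "fps_of_poly (\<Prod>c\<leftarrow>cs. [:1, -c:]) = (\<Prod>c\<leftarrow>cs. 1 - fps_const c * fps_X)"
    by (induction cs) (simp_all add: fps_of_poly_mult fps_of_poly_pCons mult.commute del: mult_pCons_left)
  then have "fps_of_poly q * Abs_fps (\<lambda>k. \<Sum>c\<leftarrow>cs. c ^ k)
    = of_nat (length cs) * fps_of_poly q - fps_X * fps_deriv (fps_of_poly q)"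
    using fps_power_sums[of cs] by (simp add: q_def)
  then have "fps_nth (fps_of_poly q * Abs_fps (\<lambda>k. \<Sum>c\<leftarrow>cs. c ^ k)) k
    = fps_nth (fps_const (of_nat (length cs)) * fps_of_poly q - fps_X * fps_deriv (fps_of_poly q)) k"
    by (simp add: fps_of_nat)
  moreover have "fps_nth (fps_X * fps_deriv (fps_of_poly q)) k = of_nat k * coeff q k"
    by (cases k) simp_all
  ultimately show ?thesis
    by (simp add: fps_mult_nth[of "fps_of_poly q"] atLeast0AtMost left_diff_distrib)
qed

section \<open>Slices over the circle\<close>

lemma degree_prod_list_linear:
  fixes as :: "'a :: idom list"
  shows "degree (\<Prod>x\<leftarrow>as. [:-x, 1:]) = length as"
proof -
  have "(\<Prod>x\<leftarrow>as. [:-x, 1:]) \<noteq> 0 \<and> degree (\<Prod>x\<leftarrow>as. [:-x, 1:]) = length as"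
    by (induction as) (auto simp: degree_mult_eq simp del: mult_pCons_left)
  then show ?thesis ..
qed

text \<open>Atorality is expressed by coprimality with the reflection; finiteness of the set of
  singular z2-coordinates is derived from it in \<open>finite_S\<close>.\<close>

locale stable_poly =
  fixes p :: "complex poly poly"
  assumes no_zeros: "norm a < 1 \<Longrightarrow> norm b < 1 \<Longrightarrow> eval2 p a b \<noteq> 0"
    and coprime_reflect: "coprime p (reflect2 p)"
begin

abbreviation P where "P \<equiv> eval2 p"
abbreviation Pt where "Pt \<equiv> eval2 (reflect2 p)"
text \<open>The leading coefficient of the reflection in z1 for the formal degree. It has no zero on
  the circle, so every slice of the reflection there has degree exactly
  \<open>deg1 p\<close>.\<close>

abbreviation L where "L \<equiv> coeff (reflect2 p) (deg1 p)"
abbreviation S where "S \<equiv> snd ` sing P"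

text \<open>A relation, because no order of the roots is canonical: what is proved for every such
  list must be symmetric in the roots.\<close>

definition roots :: "complex \<Rightarrow> complex list \<Rightarrow> bool" where
  "roots b as \<longleftrightarrow> length as = deg1 p \<and>
     slice (reflect2 p) b = smult (poly L b) (\<Prod>x\<leftarrow>as. [:-x, 1:])"

text \<open>If the slice of \<open>p\<close> vanished, so would that of the reflection, and z2 - b
  would be a common factor.\<close>

lemma slice_nonzero:
  assumes "norm b = 1"
  shows "slice p b \<noteq> 0"
proof
  assume 0: "slice p b = 0"
  have "slice (reflect2 p) b = 0"
  proof (rule poly_eqI)
    fix i show "coeff (slice (reflect2 p) b) i = coeff 0 i"
    proof (cases "i \<le> deg1 p")
      case True
      then show ?thesis using coeff_slice_reflect2[OF assms True] 0 by (simp del: coeff_slice)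
    qed (simp add: coeff_reflect2_beyond)
  qed
  then have "[:[:-b, 1:]:] dvd p" "[:[:-b, 1:]:] dvd reflect2 p"
    using 0 slice_eq_0_imp_dvd by auto
  then have "is_unit [:[:-b, 1:]:]" using coprime_reflect coprime_common_divisor by blast
  then show False by (simp add: is_unit_const_poly_iff is_unit_poly_iff)
qed

text \<open>The Harnack inequality for the slices at r b has a constant independent of r, since it
  uses the formal degree. As r tends to 1, a zero at a single point of the disk spreads to the whole
  disk, contradicting \<open>slice_nonzero\<close>.\<close>

lemma nonzero_disk_circle:
  assumes "norm a < 1" "norm b = 1"
  shows "P a b \<noteq> 0"
proof
  assume 0: "P a b = 0"
  define C where "C = (1 + 2 / (1 - norm a)) ^ deg1 p"
  have z: "P c b = 0" if c: "norm c < 1" for c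
  proof -
    have lim: "((\<lambda>r. norm (P w (of_real r * b))) \<longlongrightarrow> norm (P w (of_real 1 * b))) (at_left 1)" for w
      unfolding eval2_altdef by (intro tendsto_intros)
    have "norm (P c (of_real 1 * b)) \<le> C * norm (P a (of_real 1 * b))"
    proof (rule tendsto_le[OF _ tendsto_mult[OF tendsto_const lim] lim])
      have "\<forall>\<^sub>F r in at_left (1::real). r \<in> {0<..<1}"
        by (rule eventually_at_left_real) simp
      then show "\<forall>\<^sub>F r in at_left (1::real). norm (P c (of_real r * b)) \<le> C * norm (P a (of_real r * b))"
      proof eventually_elim
        case (elim r)
        then have "norm (of_real r * b) < 1" using assms by (simp add: norm_mult)
        then show ?case unfolding C_def poly_slice[symmetric]
          using no_zeros assms(1) c degree_slice_le[of p "of_real r * b"]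
          by (intro norm_poly_le_of_no_zeros_in_disk) (auto simp: poly_slice deg1_def)
      qed
    qed simp
    then show ?thesis using 0 by simp
  qed
  have "slice p b = 0"
  proof (rule ccontr)
    assume "slice p b \<noteq> 0"
    then have "finite {x. poly (slice p b) x = 0}" by (rule poly_roots_finite)
    moreover have "ball 0 1 \<subseteq> {x. poly (slice p b) x = 0}" using z by (auto simp: poly_slice)
    ultimately have "finite (ball (0::complex) 1)" by (rule rev_finite_subset)
    then show False using uncountable_ball[of 1 "0::complex"] countable_finite by auto
  qed
  then show False using slice_nonzero[OF assms(2)] by simp
qed

lemma nonzero_disk_cdisk: "norm a < 1 \<Longrightarrow> norm b \<le> 1 \<Longrightarrow> P a b \<noteq> 0"
  using no_zeros nonzero_disk_circle by (metis le_less)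

lemma reflect_eval:
  assumes "norm b = 1" "z \<noteq> 0"
  shows "Pt z b = z ^ deg1 p * b ^ deg2 p * cnj (P (1 / cnj z) b)"
proof -
  have pw: "z ^ (N - j) = z ^ N * (1 / z) ^ j" if "j \<le> N" for j N
    using that assms(2) by (simp add: power_diff power_divide)
  have "Pt z b = (\<Sum>i\<le>deg1 p. coeff (slice (reflect2 p) b) i * z ^ i)"
    unfolding poly_slice[symmetric]
    using degree_slice_le degree_reflect2_le by (intro poly_eq_sum_le) (rule le_trans)
  also have "\<dots> = (\<Sum>i\<le>deg1 p. b ^ deg2 p * cnj (coeff (slice p b) (deg1 p - i)) * z ^ i)"
    by (intro sum.cong) (auto simp: coeff_slice_reflect2[OF assms(1)] simp del: coeff_slice)
  also have "\<dots> = (\<Sum>i\<le>deg1 p. b ^ deg2 p * cnj (coeff (slice p b) i) * z ^ (deg1 p - i))"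
    by (rule sum.reindex_bij_witness[of _ "\<lambda>j. deg1 p - j" "\<lambda>j. deg1 p - j"]) auto
  also have "\<dots> = (\<Sum>i\<le>deg1 p. b ^ deg2 p * cnj (coeff (slice p b) i) * (z ^ deg1 p * (1 / z) ^ i))"
    by (intro sum.cong) (auto simp: pw)
  also have "\<dots> = z ^ deg1 p * b ^ deg2 p * cnj (\<Sum>i\<le>deg1 p. coeff (slice p b) i * (1 / cnj z) ^ i)"
    by (simp add: sum_distrib_left mult_ac)
  also have "(\<Sum>i\<le>deg1 p. coeff (slice p b) i * (1 / cnj z) ^ i) = P (1 / cnj z) b"
    unfolding poly_slice[symmetric]
    by (rule poly_eq_sum_le[symmetric]) (simp add: deg1_def degree_slice_le)
  finally show ?thesis .
qed

lemma reflect_eval':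
  assumes "norm b = 1" "z \<noteq> 0"
  shows "P z b = z ^ deg1 p * b ^ deg2 p * cnj (Pt (1 / cnj z) b)"
proof -
  have b: "b * cnj b = 1" using assms(1) by (simp add: complex_norm_square[symmetric])
  have "cnj (Pt (1 / cnj z) b) = (1 / z) ^ deg1 p * cnj b ^ deg2 p * P z b"
    using reflect_eval[OF assms(1), of "1 / cnj z"] assms(2) by simp
  then have "z ^ deg1 p * b ^ deg2 p * cnj (Pt (1 / cnj z) b)
    = (z * (1 / z)) ^ deg1 p * (b * cnj b) ^ deg2 p * P z b"
    unfolding power_mult_distrib by simp
  then show ?thesis using assms(2) b by simp
qed

lemma norm_P_eq_norm_Pt:
  assumes "norm a = 1" "norm b = 1"
  shows "norm (P a b) = norm (Pt a b)"
proof -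
  have "a * cnj a = 1" using assms(1) by (simp add: complex_norm_square[symmetric])
  then have "1 / cnj a = a" by (metis divide_eq_eq mult_zero_right zero_neq_one)
  moreover have "a \<noteq> 0" using assms by auto
  ultimately show ?thesis using reflect_eval'[of b a] assms by (simp add: norm_mult norm_power)
qed

lemma poly_L: "norm b = 1 \<Longrightarrow> poly L b = b ^ deg2 p * cnj (P 0 b)"
  using coeff_slice_reflect2[of b "deg1 p" p] by (simp add: poly_slice[symmetric] poly_0_coeff_0)

lemma poly_L_nonzero: "norm b = 1 \<Longrightarrow> poly L b \<noteq> 0"
  using nonzero_disk_circle[of 0 b] by (auto simp: poly_L)

lemma norm_poly_L: "norm b = 1 \<Longrightarrow> norm (poly L b) = norm (P 0 b)"
  by (simp add: poly_L norm_mult norm_power)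

lemma L_nonzero: "L \<noteq> 0"
  using poly_L_nonzero[of 1] by auto

lemma roots_exist:
  assumes "norm b = 1"
  obtains as where "roots b as"
proof -
  have c: "coeff (slice (reflect2 p) b) (deg1 p) \<noteq> 0" using poly_L_nonzero[OF assms] by simp
  have d: "degree (slice (reflect2 p) b) = deg1 p"
    using le_degree[OF c] degree_slice_le[of "reflect2 p" b] degree_reflect2_le[of p] by linarith
  have "slice (reflect2 p) b \<noteq> 0" using c by (metis coeff_0)
  then obtain as where "length as = degree (slice (reflect2 p) b)"
      "slice (reflect2 p) b = smult (lead_coeff (slice (reflect2 p) b)) (\<Prod>x\<leftarrow>as. [:-x, 1:])"
    by (rule complex_poly_factor_list)
  then show ?thesis using that d by (simp add: roots_def)
qed

lemma Pt_roots:
  assumes "roots b as" shows "Pt z b = poly L b * (\<Prod>x\<leftarrow>as. z - x)"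
  using assms by (simp add: roots_def poly_slice[symmetric] poly_prod_list o_def)

lemma Pt_zero_iff:
  assumes "norm b = 1" "roots b as" shows "Pt z b = 0 \<longleftrightarrow> z \<in> set as"
  by (auto simp: Pt_roots[OF assms(2)] poly_L_nonzero[OF assms(1)] prod_list_zero_iff)

lemma P_roots_aux:
  assumes "norm b = 1" "roots b as" "z \<noteq> 0"
  shows "P z b = P 0 b * (\<Prod>x\<leftarrow>as. 1 - cnj x * z)"
proof -
  have b: "b * cnj b = 1" using assms(1) by (simp add: complex_norm_square[symmetric])
  have *: "z ^ length as * cnj (\<Prod>x\<leftarrow>as. 1 / cnj z - x) = (\<Prod>x\<leftarrow>as. 1 - cnj x * z)"
    using assms(3) by (induction as) (auto simp: field_simps)
  have "P z b = b ^ deg2 p * cnj (poly L b) * (z ^ deg1 p * cnj (\<Prod>x\<leftarrow>as. 1 / cnj z - x))"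
    using reflect_eval'[OF assms(1,3)] by (simp add: Pt_roots[OF assms(2)] mult_ac)
  also have "b ^ deg2 p * cnj (poly L b) = (b * cnj b) ^ deg2 p * P 0 b"
    by (simp add: poly_L[OF assms(1)] power_mult_distrib)
  finally show ?thesis using * assms(2) b by (simp add: roots_def)
qed

lemma slice_P_roots:
  assumes "norm b = 1" "roots b as"
  shows "slice p b = smult (P 0 b) (\<Prod>c\<leftarrow>map cnj as. [:1, -c:])"
proof -
  \<comment> \<open>The factorisation is known only for z different from 0. Multiplied by z, both
    sides agree everywhere, and z cancels in the polynomial ring.\<close>
  have "[:0, 1:] * slice p b = [:0, 1:] * smult (P 0 b) (\<Prod>c\<leftarrow>map cnj as. [:1, -c:])"
  proof (rule poly_ext)
    fix z
    show "poly ([:0, 1:] * slice p b) z = poly ([:0, 1:] * smult (P 0 b) (\<Prod>c\<leftarrow>map cnj as. [:1, -c:])) z"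
      using P_roots_aux[OF assms, of z]
      by (cases "z = 0") (simp_all add: poly_slice poly_prod_list o_def mult_ac)
  qed
  then show ?thesis by (metis mult_cancel_left pCons_eq_0_iff zero_neq_one)
qed

lemma P_roots:
  assumes "norm b = 1" "roots b as"
  shows "P z b = P 0 b * (\<Prod>x\<leftarrow>as. 1 - cnj x * z)"
  unfolding poly_slice[of p b z, symmetric] slice_P_roots[OF assms]
  by (simp add: poly_prod_list o_def mult.commute)

text \<open>A root x outside the closed disk would make 1 / cnj x a zero of \<open>p\<close> over b
  inside the disk.\<close>

lemma roots_norm_le:
  assumes "norm b = 1" "roots b as" "x \<in> set as"
  shows "norm x \<le> 1"
proof (rule ccontr)
  assume *: "\<not> norm x \<le> 1"
  then have "x \<noteq> 0" by auto
  have "Pt x b = 0" using Pt_zero_iff assms by blast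
  then have "P (1 / cnj x) b = 0"
    using reflect_eval[OF assms(1) \<open>x \<noteq> 0\<close>] \<open>x \<noteq> 0\<close> assms(1) by auto
  moreover have "norm (1 / cnj x) < 1" using * by (simp add: norm_divide divide_less_eq)
  ultimately show False using nonzero_disk_circle assms(1) by blast
qed

lemma roots_norm_less:
  assumes "norm b = 1" "b \<notin> S" "roots b as" "x \<in> set as"
  shows "norm x < 1"
proof (rule ccontr)
  assume "\<not> norm x < 1"
  then have x: "norm x = 1" using roots_norm_le assms by force
  have "Pt x b = 0" using Pt_zero_iff assms by blast
  then have "P x b = 0" using norm_P_eq_norm_Pt[OF x assms(1)] by simp
  then have "(x, b) \<in> sing P" using x assms(1) by (simp add: sing_def)
  then show False using assms(2) by force
qed

lemma nonzero_cdisk_circle: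
  assumes "norm a \<le> 1" "norm b = 1" "b \<notin> S"
  shows "P a b \<noteq> 0"
proof
  assume 0: "P a b = 0"
  then have "norm a = 1" using nonzero_disk_circle assms by force
  then have "(a, b) \<in> sing P" using 0 assms by (simp add: sing_def)
  then show False using assms(3) by force
qed

text \<open>At a singularity \<open>p\<close> and its reflection both vanish, so the Bezout identity
  makes the z2-coordinate a zero of r.\<close>

lemma finite_S: "finite S"
proof -
  obtain u v r where r: "r \<noteq> 0" "u * p + v * reflect2 p = [:r:]"
    by (rule coprime_bezout_const[OF coprime_reflect])
  have "S \<subseteq> {b. poly r b = 0}"
  proof
    fix b assume "b \<in> S"
    then obtain a where a: "norm a = 1" "norm b = 1" "P a b = 0" by (auto simp: sing_def)
    then have "Pt a b = 0" using norm_P_eq_norm_Pt[of a b] by simp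
    then have "eval2 [:r:] a b = 0" unfolding r(2)[symmetric] using a by simp
    then show "b \<in> {b. poly r b = 0}" by simp
  qed
  then show ?thesis using poly_roots_finite[OF r(1)] by (rule finite_subset)
qed

text \<open>With \<open>deg1 p > 0\<close> the infimum in \<open>eps1\<close> is a minimum over a
  nonempty finite set; strict bounds on the roots make it positive.\<close>

lemma eps1_roots:
  assumes "norm b = 1" "b \<notin> S" "roots b as" "deg1 p > 0"
  shows "\<forall>x\<in>set as. eps1 P Pt b \<le> 1 - norm x" "\<exists>x\<in>set as. eps1 P Pt b = 1 - norm x"
    "0 < eps1 P Pt b" "eps1 P Pt b \<le> 1"
proof -
  have ne: "set as \<noteq> {}" using assms(3,4) by (auto simp: roots_def)
  have "{1 - norm z | z. Pt z b = 0} = (\<lambda>x. 1 - norm x) ` set as"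
    using Pt_zero_iff[OF assms(1,3)] by auto
  then have e: "eps1 P Pt b = Min ((\<lambda>x. 1 - norm x) ` set as)"
    using ne assms(2) by (simp add: eps1_def cInf_eq_Min)
  show 1: "\<forall>x\<in>set as. eps1 P Pt b \<le> 1 - norm x" unfolding e by auto
  have "eps1 P Pt b \<in> (\<lambda>x. 1 - norm x) ` set as" unfolding e using ne by (intro Min_in) auto
  then show 2: "\<exists>x\<in>set as. eps1 P Pt b = 1 - norm x" by auto
  then show "0 < eps1 P Pt b" "eps1 P Pt b \<le> 1"
    using roots_norm_less[OF assms(1-3)] by force+
qed

section \<open>Rationality of the Gram sum of the roots\<close>

text \<open>Newton's identity solved recursively, with Q independent of b and of the list. The
  elementary symmetric functions are coefficients of the reflection divided by L, and each stage of
  the recursion costs one factor L.\<close>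

lemma power_sum_polynomial:
  "\<exists>Q. \<forall>b as. roots b as \<longrightarrow> poly L b ^ Suc k * (\<Sum>x\<leftarrow>as. x ^ k) = poly Q b"
proof (induction k rule: less_induct)
  case (less k)
  then obtain Q where Q: "\<And>j b as. j < k \<Longrightarrow> roots b as \<Longrightarrow>
      poly L b ^ Suc j * (\<Sum>x\<leftarrow>as. x ^ j) = poly (Q j) b" by metis
  \<comment> \<open>E i is L times the i-th coefficient of the product of the factors 1 - x z: the
    coefficients of the reflection in reverse order.\<close>
  define E where "E i = (if i \<le> deg1 p then coeff (reflect2 p) (deg1 p - i) else 0)" for i
  \<comment> \<open>Newton's identity multiplied by L^(k+1). The exponent i - 1 is what remains of
    L^k after Q (k - i) has absorbed k - i + 1 factors.\<close>
  define R where "R = smult (of_nat (deg1 p) - of_nat k) (E k * L ^ k)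
      - (\<Sum>i=1..k. E i * L ^ (i - 1) * Q (k - i))"
  have "poly L b ^ Suc k * (\<Sum>x\<leftarrow>as. x ^ k) = poly R b" if "roots b as" for b as
  proof -
    define q where "q = (\<Prod>x\<leftarrow>as. [:1, -x:])"
    define s where "s j = (\<Sum>x\<leftarrow>as. x ^ j)" for j
    let ?l = "poly L b"
    have len: "length as = deg1 p" using that by (simp add: roots_def)
    have "q = reflect_poly (\<Prod>x\<leftarrow>as. [:-x, 1:])"
      unfolding q_def
      by (induction as) (auto simp: reflect_poly_mult reflect_poly_def[of "[:_, 1:]"] simp del: mult_pCons_left)
    then have q: "coeff q i = (if i \<le> deg1 p then coeff (\<Prod>x\<leftarrow>as. [:-x, 1:]) (deg1 p - i) else 0)" for i
      by (simp add: coeff_reflect_poly degree_prod_list_linear len)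
    have "?l * coeff (\<Prod>x\<leftarrow>as. [:-x, 1:]) j = poly (coeff (reflect2 p) j) b" for j
      using that coeff_slice[of "reflect2 p" b j] by (simp add: roots_def)
    then have l: "?l * coeff q i = poly (E i) b" for i by (simp add: q E_def)
    have nw: "(\<Sum>i\<le>k. coeff q i * s (k - i)) = (of_nat (deg1 p) - of_nat k) * coeff q k"
      using newton_identity[of as k] by (simp add: q_def s_def len)
    have "(\<Sum>i\<le>k. (?l * coeff q i) * s (k - i)) = ?l * (\<Sum>i\<le>k. coeff q i * s (k - i))"
      by (simp add: sum_distrib_left mult.assoc)
    then have "(\<Sum>i\<le>k. (?l * coeff q i) * s (k - i)) = (of_nat (deg1 p) - of_nat k) * (?l * coeff q k)"
      by (simp add: nw)
    then have "(\<Sum>i\<le>k. poly (E i) b * s (k - i)) = (of_nat (deg1 p) - of_nat k) * poly (E k) b"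
      unfolding l .
    moreover have "{..k} = insert 0 {1..k}" by auto
    ultimately have "poly (E 0) b * s k = (of_nat (deg1 p) - of_nat k) * poly (E k) b - (\<Sum>i=1..k. poly (E i) b * s (k - i))"
      by (simp add: algebra_simps)
    then have "?l * s k = (of_nat (deg1 p) - of_nat k) * poly (E k) b - (\<Sum>i=1..k. poly (E i) b * s (k - i))"
      by (simp add: E_def)
    then have "?l ^ Suc k * s k = ?l ^ k * ((of_nat (deg1 p) - of_nat k) * poly (E k) b - (\<Sum>i=1..k. poly (E i) b * s (k - i)))"
      by (metis mult.assoc mult.commute power_Suc)
    also have "\<dots> = (of_nat (deg1 p) - of_nat k) * (poly (E k) b * ?l ^ k)
        - (\<Sum>i=1..k. poly (E i) b * (?l ^ k * s (k - i)))"
      by (simp add: algebra_simps sum_distrib_left)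
    also have "(\<Sum>i=1..k. poly (E i) b * (?l ^ k * s (k - i))) = (\<Sum>i=1..k. poly (E i) b * ?l ^ (i - 1) * poly (Q (k - i)) b)"
    proof (intro sum.cong refl)
      fix i assume i: "i \<in> {1..k}"
      have "poly (Q (k - i)) b = ?l ^ Suc (k - i) * s (k - i)"
        using Q[of "k - i" b as] i that by (simp add: s_def)
      moreover have "?l ^ k = ?l ^ (i - 1) * ?l ^ Suc (k - i)"
        using i by (simp add: power_add[symmetric] del: power_Suc)
      ultimately show "poly (E i) b * (?l ^ k * s (k - i)) = poly (E i) b * ?l ^ (i - 1) * poly (Q (k - i)) b"
        by (simp add: mult_ac)
    qed
    finally show ?thesis by (simp add: R_def s_def poly_sum)
  qed
  then show ?case by blast
qed

text \<open>By linearity in the powers of x; the exponent \<open>Suc (degree f)\<close> clears the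
  denominators of all power sums involved.\<close>

lemma root_sum_rational:
  "\<exists>N Q. \<forall>b as. roots b as \<longrightarrow> poly L b ^ N * (\<Sum>x\<leftarrow>as. eval2 f x b) = poly Q b"
proof -
  obtain Q where Q: "\<And>k b as. roots b as \<Longrightarrow> poly L b ^ Suc k * (\<Sum>x\<leftarrow>as. x ^ k) = poly (Q k) b"
    using power_sum_polynomial by metis
  define R where "R = (\<Sum>k\<le>degree f. coeff f k * L ^ (degree f - k) * Q k)"
  have "poly L b ^ Suc (degree f) * (\<Sum>x\<leftarrow>as. eval2 f x b) = poly R b" if r: "roots b as" for b as
  proof -
    have "eval2 f x b = (\<Sum>k\<le>degree f. poly (coeff f k) b * x ^ k)" for x
      unfolding poly_slice[symmetric] coeff_slice[symmetric] by (rule poly_eq_sum_le[OF degree_slice_le])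
    then have "(\<Sum>x\<leftarrow>as. eval2 f x b) = (\<Sum>k\<le>degree f. poly (coeff f k) b * (\<Sum>x\<leftarrow>as. x ^ k))"
      by (simp add: sum_list_sum_nth sum_distrib_left sum.swap[of _ "{0..<length as}"])
    then have "poly L b ^ Suc (degree f) * (\<Sum>x\<leftarrow>as. eval2 f x b)
       = (\<Sum>k\<le>degree f. poly (coeff f k) b * (poly L b ^ Suc (degree f) * (\<Sum>x\<leftarrow>as. x ^ k)))"
      by (simp add: sum_distrib_left mult_ac)
    also have "\<dots> = (\<Sum>k\<le>degree f. poly (coeff f k) b * poly L b ^ (degree f - k) * poly (Q k) b)"
    proof (intro sum.cong refl)
      fix k assume k: "k \<in> {..degree f}"
      then have "poly L b ^ Suc (degree f) = poly L b ^ (degree f - k) * poly L b ^ Suc k"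
        by (simp add: power_add[symmetric] del: power_Suc)
      then show "poly (coeff f k) b * (poly L b ^ Suc (degree f) * (\<Sum>x\<leftarrow>as. x ^ k))
        = poly (coeff f k) b * poly L b ^ (degree f - k) * poly (Q k) b"
        by (simp only: Q[OF r, symmetric] mult_ac)
    qed
    finally show ?thesis by (simp add: R_def poly_sum)
  qed
  then show ?thesis by blast
qed

text \<open>The sum of all entries of the Gram matrix of the Szego kernels at the roots. Summing
  over all pairs makes it symmetric in the list while the closest root still dominates.\<close>

definition gram :: "complex list \<Rightarrow> complex" where
  "gram as = (\<Sum>x\<leftarrow>as. \<Sum>y\<leftarrow>as. 1 / (1 - cnj y * x))"

text \<open>By the logarithmic derivative the inner sum at a root x is (m p - x p') / p, with p' the
  z1-derivative. There the reflection vanishes, so u p = r, and r times the inner sum is the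
  polynomial G at (x, b).\<close>

lemma gram_rational:
  "\<exists>A B. B \<noteq> 0 \<and> (\<forall>b as. norm b = 1 \<longrightarrow> b \<notin> S \<longrightarrow> roots b as \<longrightarrow> poly B b * gram as = poly A b)"
proof -
  obtain u v r where r: "r \<noteq> 0" "u * p + v * reflect2 p = [:r:]"
    by (rule coprime_bezout_const[OF coprime_reflect])
  define G where "G = u * (of_nat (deg1 p) * p - [:0, 1:] * pderiv p)"
  obtain N Q where Q: "\<And>b as. roots b as \<Longrightarrow> poly L b ^ N * (\<Sum>x\<leftarrow>as. eval2 G x b) = poly Q b"
    using root_sum_rational by blast
  have "poly (r * L ^ N) b * gram as = poly Q b"
    if b: "norm b = 1" "b \<notin> S" and as: "roots b as" for b as
  proof -
    have len: "length as = deg1 p" using as by (simp add: roots_def)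
    have "poly r b * (\<Sum>y\<leftarrow>as. 1 / (1 - cnj y * x)) = eval2 G x b" if x: "x \<in> set as" for x
    proof -
      let ?q = "\<Prod>c\<leftarrow>map cnj as. [:1, -c:]"
      have "\<forall>c\<in>set (map cnj as). 1 - c * x \<noteq> 0"
        using one_minus_cnj_mult_neq_0 roots_norm_less[OF b as] x by (auto simp: less_imp_le)
      from logderiv_prod_one_minus[OF this]
      have "P 0 b * (poly ?q x * (\<Sum>y\<leftarrow>as. 1 / (1 - cnj y * x)))
        = P 0 b * (of_nat (deg1 p) * poly ?q x - x * poly (pderiv ?q) x)"
        by (simp add: len o_def)
      moreover have "P x b = P 0 b * poly ?q x"
        unfolding poly_slice[of p b x, symmetric] slice_P_roots[OF b(1) as] by simp
      moreover have "eval2 (pderiv p) x b = P 0 b * poly (pderiv ?q) x"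
        unfolding poly_slice[symmetric, of "pderiv p"] slice_pderiv slice_P_roots[OF b(1) as]
        by (simp add: pderiv_smult)
      ultimately have 1: "P x b * (\<Sum>y\<leftarrow>as. 1 / (1 - cnj y * x))
          = of_nat (deg1 p) * P x b - x * eval2 (pderiv p) x b"
        by (simp add: algebra_simps)
      have "Pt x b = 0" using Pt_zero_iff b as x by blast
      then have "eval2 u x b * P x b = poly r b"
        using arg_cong[OF r(2), of "\<lambda>f. eval2 f x b"] by simp
      then have "poly r b * (\<Sum>y\<leftarrow>as. 1 / (1 - cnj y * x))
         = eval2 u x b * (P x b * (\<Sum>y\<leftarrow>as. 1 / (1 - cnj y * x)))" by (simp add: mult.assoc)
      also have "\<dots> = eval2 G x b" unfolding 1 G_def
        by (simp add: eval2_altdef)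
      finally show ?thesis .
    qed
    then have "poly r b * gram as = (\<Sum>x\<leftarrow>as. eval2 G x b)"
      unfolding gram_def by (simp add: sum_list_const_mult[symmetric] cong: map_cong)
    moreover have "poly (r * L ^ N) b * gram as = poly L b ^ N * (poly r b * gram as)" by simp
    ultimately show ?thesis using Q[OF as] by simp
  qed
  moreover have "r * L ^ N \<noteq> 0" using r(1) L_nonzero by simp
  ultimately show ?thesis by blast
qed

text \<open>Real parts of all terms are nonnegative, so the diagonal term of a closest root x0
  survives: 1 / (1 - |x0|^2) is at least 1 / (2 eps1), as 1 + |x0| <= 2. Conversely each of the m^2
  terms has modulus at most 1 / eps1.\<close>

lemma norm_gram_bounds:
  assumes "norm b = 1" "b \<notin> S" "roots b as" "deg1 p > 0"
  shows "1 / (2 * eps1 P Pt b) \<le> norm (gram as)" "norm (gram as) \<le> (real (deg1 p))\<^sup>2 / eps1 P Pt b"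
proof -
  let ?e = "eps1 P Pt b"
  note e = eps1_roots[OF assms]
  have len: "length as = deg1 p" using assms(3) by (simp add: roots_def)
  have small: "norm (cnj y * x) \<le> 1 - ?e" if "x \<in> set as" "y \<in> set as" for x y
  proof -
    have "norm (cnj y * x) \<le> norm x"
      using roots_norm_less[OF assms(1-3)] that by (simp add: norm_mult mult_left_le_one_le less_imp_le)
    then show ?thesis using e(1) that by force
  qed
  have Re_ge: "Re (1 / (1 - w)) \<ge> 0" if "norm w < 1" for w :: complex
    using that abs_Re_le_cmod[of w] by (simp add: Re_divide)
  have up: "norm (1 / (1 - cnj y * x)) \<le> 1 / ?e" if "x \<in> set as" "y \<in> set as" for x y
  proof -
    have "?e \<le> norm (1 - cnj y * x)"
      using small[OF that] norm_triangle_ineq2[of 1 "cnj y * x"] by simp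
    then show ?thesis using e(3) by (simp add: norm_divide frac_le)
  qed
  have Re_sum_list: "Re (sum_list (map f xs)) = (\<Sum>x\<leftarrow>xs. Re (f x))" for f and xs :: "complex list"
    by (induction xs) auto
  obtain x0 where x0: "x0 \<in> set as" "?e = 1 - norm x0" using e(2) by blast
  have nn: "0 \<le> Re (1 / (1 - cnj y * x))" if "x \<in> set as" "y \<in> set as" for x y
    using small[OF that] e(3) by (intro Re_ge) simp
  have "1 / (2 * ?e) \<le> 1 / (1 - (norm x0)\<^sup>2)"
  proof -
    have "1 - (norm x0)\<^sup>2 = ?e * (1 + norm x0)" by (simp add: x0 power2_eq_square algebra_simps)
    also have "\<dots> \<le> ?e * 2" using e(3) x0(2) by (intro mult_left_mono) auto
    finally show ?thesis using e(3) x0 roots_norm_less[OF assms(1-3) x0(1)]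
      by (intro frac_le) (auto simp: power_less_one_iff abs_square_less_1)
  qed
  also have "1 / (1 - (norm x0)\<^sup>2) = Re (1 / (1 - cnj x0 * x0))"
  proof -
    have "1 - cnj x0 * x0 = of_real (1 - (norm x0)\<^sup>2)"
      by (simp only: of_real_diff of_real_1 complex_norm_square mult.commute)
    then show ?thesis by (metis Re_complex_of_real of_real_1 of_real_divide)
  qed
  also have "\<dots> \<le> (\<Sum>y\<leftarrow>as. Re (1 / (1 - cnj y * x0)))"
    using x0 nn by (intro member_le_sum_list) auto
  also have "\<dots> \<le> (\<Sum>x\<leftarrow>as. \<Sum>y\<leftarrow>as. Re (1 / (1 - cnj y * x)))"
    using x0 nn by (intro member_le_sum_list) (auto intro!: sum_list_nonneg)
  also have "\<dots> = Re (gram as)" by (simp only: gram_def Re_sum_list)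
  also have "\<dots> \<le> norm (gram as)" by (rule complex_Re_le_cmod)
  finally show "1 / (2 * ?e) \<le> norm (gram as)" .
  have ns: "norm (sum_list (map f xs)) \<le> real (length xs) * c" if "\<And>x. x \<in> set xs \<Longrightarrow> norm (f x) \<le> c"
    for f :: "complex \<Rightarrow> complex" and xs c
    using that
  proof (induction xs)
    case (Cons x xs)
    then have "norm (f x) \<le> c" "norm (sum_list (map f xs)) \<le> real (length xs) * c" by auto
    then show ?case using norm_triangle_ineq[of "f x" "sum_list (map f xs)"] by (simp add: algebra_simps)
  qed simp
  have "norm (gram as) \<le> real (length as) * (real (length as) * (1 / ?e))"
    unfolding gram_def using up by (intro ns)
  then show "norm (gram as) \<le> (real (deg1 p))\<^sup>2 / ?e" by (simp add: len power2_eq_square)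
qed

end

section \<open>Contact orders\<close>

lemma infinite_unit_circle: "infinite {b::complex. norm b = 1}"
proof
  assume fin: "finite {b::complex. norm b = 1}"
  have "{0..1} \<subseteq> Re ` {b::complex. norm b = 1}"
  proof
    fix x :: real assume "x \<in> {0..1}"
    then have "norm (Complex x (sqrt (1 - x\<^sup>2))) = 1"
      by (simp add: cmod_def power_le_one)
    then show "x \<in> Re ` {b::complex. norm b = 1}" by (intro image_eqI[of _ _ "Complex x (sqrt (1 - x\<^sup>2))"]) auto
  qed
  then have "finite {0..1::real}" using finite_subset finite_imageI[OF fin] by blast
  then show False using infinite_Icc[of "0::real" 1] by simp
qed

text \<open>After the full power of z - \<tau> is split off, the cofactor stays within a factor 2 of
  its nonzero value at \<tau>.\<close>

lemma poly_local_order: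
  fixes A :: "complex poly"
  assumes "A \<noteq> 0"
  shows "\<exists>a::nat. \<exists>\<delta>>0. \<exists>c>0. \<exists>C>0. \<forall>\<zeta>. norm (\<zeta> - \<tau>) < \<delta> \<longrightarrow>
    c * norm (\<zeta> - \<tau>) ^ a \<le> norm (poly A \<zeta>) \<and> norm (poly A \<zeta>) \<le> C * norm (\<zeta> - \<tau>) ^ a"
proof -
  obtain q where q: "A = [:-\<tau>, 1:] ^ order \<tau> A * q" "\<not> [:-\<tau>, 1:] dvd q"
    using order_decomp[OF assms] by blast
  have nz: "poly q \<tau> \<noteq> 0" using q(2) by (simp add: poly_eq_0_iff_dvd)
  have "((\<lambda>\<zeta>. norm (poly q \<zeta>)) \<longlongrightarrow> norm (poly q \<tau>)) (nhds \<tau>)"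
    by (intro tendsto_intros) (simp add: filterlim_ident)
  from order_tendstoD(1)[OF this, of "norm (poly q \<tau>) / 2"] order_tendstoD(2)[OF this, of "2 * norm (poly q \<tau>)"]
  have "\<forall>\<^sub>F \<zeta> in nhds \<tau>. norm (poly q \<tau>) / 2 < norm (poly q \<zeta>)"
    "\<forall>\<^sub>F \<zeta> in nhds \<tau>. norm (poly q \<zeta>) < 2 * norm (poly q \<tau>)"
    using nz by simp_all
  then have "\<forall>\<^sub>F \<zeta> in nhds \<tau>. norm (poly q \<tau>) / 2 < norm (poly q \<zeta>) \<and> norm (poly q \<zeta>) < 2 * norm (poly q \<tau>)"
    by eventually_elim auto
  then obtain \<delta> where d: "\<delta> > 0" "\<And>\<zeta>. dist \<zeta> \<tau> < \<delta> \<Longrightarrow>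
      norm (poly q \<tau>) / 2 < norm (poly q \<zeta>) \<and> norm (poly q \<zeta>) < 2 * norm (poly q \<tau>)"
    unfolding eventually_nhds_metric by blast
  have "norm (poly q \<tau>) / 2 * norm (\<zeta> - \<tau>) ^ order \<tau> A \<le> norm (poly A \<zeta>) \<and>
        norm (poly A \<zeta>) \<le> 2 * norm (poly q \<tau>) * norm (\<zeta> - \<tau>) ^ order \<tau> A"
    if "norm (\<zeta> - \<tau>) < \<delta>" for \<zeta>
  proof -
    have "norm (poly A \<zeta>) = norm (poly q \<zeta>) * norm (\<zeta> - \<tau>) ^ order \<tau> A"
      by (subst q(1)) (simp add: norm_mult norm_power)
    moreover have "norm (poly q \<tau>) / 2 \<le> norm (poly q \<zeta>)" "norm (poly q \<zeta>) \<le> 2 * norm (poly q \<tau>)"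
      using d(2)[of \<zeta>] that by (auto simp: dist_norm)
    ultimately show ?thesis by (metis mult_right_mono norm_ge_zero zero_le_power)
  qed
  then show ?thesis using d(1) nz
    by (intro exI[of _ "order \<tau> A"] exI[of _ \<delta>] exI[of _ "norm (poly q \<tau>) / 2"]
          exI[of _ "2 * norm (poly q \<tau>)"] conjI) auto
qed

lemma norm_circle_diff:
  assumes "norm (\<tau>::complex) = 1"
  shows "norm (\<tau> * cis t - \<tau>) = 2 * \<bar>sin (t / 2)\<bar>"
proof -
  have "\<tau> * cis t - \<tau> = \<tau> * (cis t - 1)" by (simp add: algebra_simps)
  then show ?thesis using assms dist_exp_i_1[of t] by (simp add: norm_mult cis_conv_exp)
qed

lemma eventually_punctured_circle:
  assumes "norm (\<tau>::complex) = 1" "\<delta> > 0"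
  shows "\<forall>\<^sub>F t in at_right 0. norm (\<tau> * cis t) = 1 \<and> 0 < norm (\<tau> * cis t - \<tau>) \<and> norm (\<tau> * cis t - \<tau>) < \<delta>"
proof -
  have 1: "\<forall>\<^sub>F t in at_right 0. t \<in> {0<..<pi}" by (rule eventually_at_right_real) simp
  have "((\<lambda>t. norm (\<tau> * cis t - \<tau>)) \<longlongrightarrow> norm (\<tau> * cis 0 - \<tau>)) (at_right 0)"
    unfolding cis_conv_exp by (intro tendsto_intros)
  then have 2: "\<forall>\<^sub>F t in at_right 0. norm (\<tau> * cis t - \<tau>) < \<delta>"
    using assms(2) by (intro order_tendstoD) auto
  from 1 2 show ?thesis
  proof eventually_elim
    case (elim t)
    then have "sin (t / 2) > 0" by (intro sin_gt_zero) auto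
    then show ?case using elim assms by (simp add: norm_mult norm_circle_diff[OF assms(1)])
  qed
qed

lemma tendsto_circle: "((\<lambda>t. \<tau> * cis t) \<longlongrightarrow> \<tau>) (at_right 0)"
proof -
  have "((\<lambda>t. \<tau> * cis t) \<longlongrightarrow> \<tau> * cis 0) (at_right 0)"
    unfolding cis_conv_exp by (intro tendsto_intros)
  then show ?thesis by simp
qed

text \<open>If K' exceeded K, the ratio of the two powers would tend to 0 along the circle towards
  \<tau>, against c > 0.\<close>

lemma powr_exponent_le_of_local_bound:
  fixes \<tau> :: complex
  assumes "norm \<tau> = 1" "\<delta> > 0" "c > 0"
    and le: "\<And>\<zeta>. norm \<zeta> = 1 \<Longrightarrow> 0 < norm (\<zeta> - \<tau>) \<Longrightarrow> norm (\<zeta> - \<tau>) < \<delta> \<Longrightarrow>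
      c * norm (\<zeta> - \<tau>) powr K \<le> C * norm (\<zeta> - \<tau>) powr K'"
  shows "K' \<le> K"
proof (rule ccontr)
  assume "\<not> K' \<le> K"
  define x where "x t = norm (\<tau> * cis t - \<tau>)" for t
  have "((\<lambda>t. norm (\<tau> * cis t - \<tau>)) \<longlongrightarrow> norm (\<tau> - \<tau>)) (at_right 0)"
    by (intro tendsto_intros tendsto_circle)
  then have x0: "(x \<longlongrightarrow> 0) (at_right 0)" by (simp add: x_def[abs_def])
  have "((\<lambda>t. x t powr (K' - K)) \<longlongrightarrow> 0) (at_right 0)"
    using \<open>\<not> K' \<le> K\<close> by (intro tendsto_zero_powrI[OF x0 tendsto_const]) (auto simp: x_def)
  then have "((\<lambda>t. C * x t powr (K' - K)) \<longlongrightarrow> C * 0) (at_right 0)"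
    by (intro tendsto_intros)
  moreover have "\<forall>\<^sub>F t in at_right 0. c \<le> C * x t powr (K' - K)"
    using eventually_punctured_circle[OF assms(1,2)]
  proof eventually_elim
    case (elim t)
    then have "c * x t powr K \<le> C * x t powr K'" unfolding x_def by (intro le) auto
    moreover have "x t powr K > 0" using elim by (simp add: x_def)
    ultimately show ?case by (simp add: powr_diff field_simps)
  qed
  ultimately have "c \<le> C * 0" by (intro tendsto_lowerbound) auto
  then show False using assms(3) by simp
qed

text \<open>Together with existence this gives \<open>THE\<close> in the contact order its intended
  value.\<close>

lemma contact_at_unique:
  assumes "norm \<tau> = 1" "contact_at F Ft \<tau> K" "contact_at F Ft \<tau> K'"
  shows "K = K'"
proof -
  have "K' \<le> K" if K: "contact_at F Ft \<tau> K" and K': "contact_at F Ft \<tau> K'" for K K'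
  proof -
    obtain d c C where 1: "d > 0" "c > 0" "\<forall>\<zeta>. norm \<zeta> = 1 \<and> norm (\<zeta> - \<tau>) < d \<longrightarrow>
         c * norm (\<tau> - \<zeta>) powr K \<le> eps1 F Ft \<zeta> \<and> eps1 F Ft \<zeta> \<le> C * norm (\<tau> - \<zeta>) powr K"
      using K unfolding contact_at_def by blast
    obtain d' c' C' where 2: "d' > 0" "\<forall>\<zeta>. norm \<zeta> = 1 \<and> norm (\<zeta> - \<tau>) < d' \<longrightarrow>
         c' * norm (\<tau> - \<zeta>) powr K' \<le> eps1 F Ft \<zeta> \<and> eps1 F Ft \<zeta> \<le> C' * norm (\<tau> - \<zeta>) powr K'"
      using K' unfolding contact_at_def by blast
    show ?thesis
    proof (rule powr_exponent_le_of_local_bound[OF assms(1), of "min d d'" c _ C'])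
      fix \<zeta> assume "norm \<zeta> = 1" "norm (\<zeta> - \<tau>) < min d d'"
      then show "c * norm (\<zeta> - \<tau>) powr K \<le> C' * norm (\<zeta> - \<tau>) powr K'"
        using spec[OF 1(3), of \<zeta>] spec[OF 2(2), of \<zeta>] by (simp add: norm_minus_commute)
    qed (use 1 2 in auto)
  qed
  from this[OF assms(2,3)] this[OF assms(3,2)] show ?thesis by simp
qed

context stable_poly begin

text \<open>If \<open>p\<close> is free of z1, a zero over b on the circle is also a zero at (0, b),
  which lies in the disk times the circle.\<close>

lemma S_empty_of_deg1_0:
  assumes "deg1 p = 0" shows "S = {}"
proof (rule ccontr)
  assume "S \<noteq> {}"
  then obtain a b where ab: "norm b = 1" "P a b = 0" by (auto simp: sing_def)
  obtain c where "p = [:c:]" using assms degree_eq_zeroE unfolding deg1_def by blast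
  then have "P 0 b = 0" using ab by simp
  then show False using nonzero_disk_circle[of 0 b] ab by simp
qed

text \<open>\<open>eps1\<close> is comparable to 1 / |gram| = |B| / |A| for polynomials A and B in
  z2, and these have definite vanishing orders at \<tau>. The sign of K is left open here.\<close>

lemma eps1_local_powr:
  assumes "deg1 p > 0" "norm \<tau> = 1"
  shows "\<exists>K \<delta> c C. \<delta> > 0 \<and> c > 0 \<and> C > 0 \<and>
    (\<forall>\<zeta>. norm \<zeta> = 1 \<longrightarrow> 0 < norm (\<zeta> - \<tau>) \<longrightarrow> norm (\<zeta> - \<tau>) < \<delta> \<longrightarrow> \<zeta> \<notin> S \<and>
      c * norm (\<zeta> - \<tau>) powr K \<le> eps1 P Pt \<zeta> \<and> eps1 P Pt \<zeta> \<le> C * norm (\<zeta> - \<tau>) powr K)"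
proof -
  obtain A B where B: "B \<noteq> 0"
    and AB: "\<And>b as. norm b = 1 \<Longrightarrow> b \<notin> S \<Longrightarrow> roots b as \<Longrightarrow> poly B b * gram as = poly A b"
    using gram_rational by metis
  \<comment> \<open>Otherwise the Gram sum would vanish off a finite subset of the circle, although
    it is bounded below by 1 / (2 eps1).\<close>
  have "A \<noteq> 0"
  proof
    assume "A = 0"
    have "{b. norm b = 1} \<subseteq> S \<union> {b. poly B b = 0}"
    proof (intro subsetI UnCI CollectI)
      fix b assume b: "b \<in> {b. norm b = 1}" "b \<notin> {b. poly B b = 0}"
      show "b \<in> S"
      proof (rule ccontr)
        assume "b \<notin> S"
        obtain as where as: "roots b as" using roots_exist b by blast
        then have "gram as = 0" using AB[of b as] b \<open>A = 0\<close> \<open>b \<notin> S\<close> by auto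
        moreover have "0 < 1 / (2 * eps1 P Pt b)"
          using eps1_roots(3)[OF _ \<open>b \<notin> S\<close> as assms(1)] b by simp
        ultimately show False using norm_gram_bounds(1)[OF _ \<open>b \<notin> S\<close> as assms(1)] b by simp
      qed
    qed
    then have "finite {b::complex. norm b = 1}"
      using finite_S poly_roots_finite[OF B] finite_subset finite_UnI by metis
    then show False using infinite_unit_circle by simp
  qed
  obtain a dA cA CA where A: "dA > 0" "cA > 0" "CA > 0" "\<And>\<zeta>. norm (\<zeta> - \<tau>) < dA \<Longrightarrow>
    cA * norm (\<zeta> - \<tau>) ^ a \<le> norm (poly A \<zeta>) \<and> norm (poly A \<zeta>) \<le> CA * norm (\<zeta> - \<tau>) ^ a"
    using poly_local_order[OF \<open>A \<noteq> 0\<close>, of \<tau>] by metis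
  obtain b dB cB CB where B: "dB > 0" "cB > 0" "CB > 0" "\<And>\<zeta>. norm (\<zeta> - \<tau>) < dB \<Longrightarrow>
    cB * norm (\<zeta> - \<tau>) ^ b \<le> norm (poly B \<zeta>) \<and> norm (poly B \<zeta>) \<le> CB * norm (\<zeta> - \<tau>) ^ b"
    using poly_local_order[OF \<open>B \<noteq> 0\<close>, of \<tau>] by metis
  obtain dS where S: "dS > 0" "\<And>x. x \<in> S \<Longrightarrow> x \<noteq> \<tau> \<Longrightarrow> dS \<le> dist \<tau> x"
    using finite_set_avoid[OF finite_S, of \<tau>] by blast
  \<comment> \<open>Here a and b are the vanishing orders of A and B at \<tau>.\<close>
  define K where "K = real b - real a"
  define m2 where "m2 = (real (deg1 p))\<^sup>2"
  have "\<zeta> \<notin> S \<and> cB / (2 * CA) * norm (\<zeta> - \<tau>) powr K \<le> eps1 P Pt \<zeta> \<and>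
      eps1 P Pt \<zeta> \<le> m2 * CB / cA * norm (\<zeta> - \<tau>) powr K"
    if z: "norm \<zeta> = 1" "0 < norm (\<zeta> - \<tau>)" "norm (\<zeta> - \<tau>) < min dS (min dA dB)" for \<zeta>
  proof -
    define x where "x = norm (\<zeta> - \<tau>)"
    have x: "x > 0" using z by (simp add: x_def)
    have nS: "\<zeta> \<notin> S" using S(2)[of \<zeta>] z by (auto simp: dist_norm norm_minus_commute)
    obtain as where as: "roots \<zeta> as" using roots_exist z by blast
    note g = norm_gram_bounds[OF z(1) nS as assms(1)]
    note e = eps1_roots(3)[OF z(1) nS as assms(1)]
    define \<alpha> where "\<alpha> = norm (poly A \<zeta>)"
    define \<beta> where "\<beta> = norm (poly B \<zeta>)"
    have al: "cA * x ^ a \<le> \<alpha>" "\<alpha> \<le> CA * x ^ a" using A(4)[of \<zeta>] z by (auto simp: \<alpha>_def x_def)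
    have be: "cB * x ^ b \<le> \<beta>" "\<beta> \<le> CB * x ^ b" using B(4)[of \<zeta>] z by (auto simp: \<beta>_def x_def)
    have pos: "x ^ a > 0" "x ^ b > 0" using x by auto
    have ap: "\<alpha> > 0" using al(1) A(2) pos by (smt (verit) mult_pos_pos)
    have bp: "\<beta> > 0" using be(1) B(2) pos by (smt (verit) mult_pos_pos)
    have "\<beta> * norm (gram as) = \<alpha>"
      unfolding \<alpha>_def \<beta>_def using AB[OF z(1) nS as] by (metis norm_mult)
    then have gm: "norm (gram as) = \<alpha> / \<beta>" using bp by (simp add: field_simps)
    have pw: "x powr K = x ^ b / x ^ a"
      using x by (simp add: K_def powr_diff powr_realpow)
    have "cB / (2 * CA) * x powr K = (cB * x ^ b) / (2 * (CA * x ^ a))" by (simp add: pw)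
    also have "\<dots> \<le> \<beta> / (2 * \<alpha>)"
      using be al ap A B pos bp by (intro frac_le) auto
    also have "\<dots> \<le> eps1 P Pt \<zeta>" using g(1) e ap bp unfolding gm by (simp add: field_simps)
    finally have 1: "cB / (2 * CA) * x powr K \<le> eps1 P Pt \<zeta>" .
    have "eps1 P Pt \<zeta> \<le> m2 * (\<beta> / \<alpha>)"
      using g(2) e ap bp unfolding gm m2_def by (simp add: field_simps)
    also have "\<dots> \<le> m2 * ((CB * x ^ b) / (cA * x ^ a))"
      using be al ap A B pos bp by (intro mult_left_mono frac_le) (auto simp: m2_def)
    also have "\<dots> = m2 * CB / cA * x powr K" by (simp add: pw)
    finally show ?thesis using 1 nS by (simp add: x_def)
  qed
  moreover have "m2 > 0" using assms by (simp add: m2_def)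
  ultimately show ?thesis
    using A B S(1)
    by (intro exI[of _ K] exI[of _ "min dS (min dA dB)"] exI[of _ "cB / (2 * CA)"]
        exI[of _ "m2 * CB / cA"] conjI) auto
qed

lemma S_norm: "\<tau> \<in> S \<Longrightarrow> norm \<tau> = 1"
  by (auto simp: sing_def)

text \<open>Only K > 0 is missing. If K <= 0, the roots over b near \<tau> keep a distance c from
  the singular point a, so the reflection at (a, b) is at least |L(b)| c^m in modulus; letting b
  tend to \<tau> contradicts its vanishing at (a, \<tau>).\<close>

lemma contact_at_exists:
  assumes "\<tau> \<in> S"
  shows "\<exists>K. contact_at P Pt \<tau> K"
proof -
  have deg: "deg1 p > 0" using S_empty_of_deg1_0 assms by blast
  note t = S_norm[OF assms]
  obtain K :: real and \<delta> c C where K: "\<delta> > 0" "c > 0" "C > 0"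
    "\<And>\<zeta>. norm \<zeta> = 1 \<Longrightarrow> 0 < norm (\<zeta> - \<tau>) \<Longrightarrow> norm (\<zeta> - \<tau>) < \<delta> \<Longrightarrow> \<zeta> \<notin> S \<and>
      c * norm (\<zeta> - \<tau>) powr K \<le> eps1 P Pt \<zeta> \<and> eps1 P Pt \<zeta> \<le> C * norm (\<zeta> - \<tau>) powr K"
    using eps1_local_powr[OF deg t] by metis
  obtain a where a: "norm a = 1" "P a \<tau> = 0" using assms by (auto simp: sing_def)
  then have Pt0: "Pt a \<tau> = 0" using norm_P_eq_norm_Pt[of a \<tau>] t by simp
  have "K > 0"
  proof (rule ccontr)
    assume "\<not> K > 0"
    have md: "min \<delta> 1 > 0" using K(1) by simp
    have "((\<lambda>s. norm (Pt a (\<tau> * cis s))) \<longlongrightarrow> norm (Pt a \<tau>)) (at_right 0)"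
      unfolding eval2_altdef by (intro tendsto_intros tendsto_circle)
    moreover have "((\<lambda>s. norm (poly L (\<tau> * cis s)) * c ^ deg1 p) \<longlongrightarrow> norm (poly L \<tau>) * c ^ deg1 p) (at_right 0)"
      by (intro tendsto_intros tendsto_circle)
    moreover have "\<forall>\<^sub>F s in at_right 0. norm (poly L (\<tau> * cis s)) * c ^ deg1 p \<le> norm (Pt a (\<tau> * cis s))"
      using eventually_punctured_circle[OF t md]
    proof eventually_elim
      case (elim s)
      define b where "b = \<tau> * cis s"
      have b: "norm b = 1" "0 < norm (b - \<tau>)" "norm (b - \<tau>) < 1" "norm (b - \<tau>) < \<delta>"
        using elim by (auto simp: b_def)
      have nS: "b \<notin> S" using K(4)[OF b(1,2,4)] by simp
      obtain as where as: "roots b as" using roots_exist b by blast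
      have "1 \<le> norm (b - \<tau>) powr K"
        using b \<open>\<not> K > 0\<close> powr_mono'[of K 0 "norm (b - \<tau>)"] by simp
      then have "c * 1 \<le> c * norm (b - \<tau>) powr K" using K(2) by (intro mult_left_mono) auto
      then have "c \<le> eps1 P Pt b" using K(4)[OF b(1,2,4)] by simp
      then have c: "c \<le> norm (a - x)" if "x \<in> set as" for x
        using eps1_roots(1)[OF b(1) nS as deg] that norm_triangle_ineq2[of a x] a(1) by force
      have "c ^ length xs \<le> norm (\<Prod>x\<leftarrow>xs. a - x)" if "set xs \<subseteq> set as" for xs
        using that
      proof (induction xs)
        case (Cons x xs)
        then show ?case using c[of x] K(2) by (auto simp: norm_mult intro!: mult_mono)
      qed simp
      then have "c ^ deg1 p \<le> norm (\<Prod>x\<leftarrow>as. a - x)" using as by (metis order_refl roots_def)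
      then have "norm (poly L b) * c ^ deg1 p \<le> norm (poly L b) * norm (\<Prod>x\<leftarrow>as. a - x)"
        by (intro mult_left_mono) auto
      then show ?case using Pt_roots[OF as, of a] by (simp add: b_def norm_mult)
    qed
    ultimately have "norm (poly L \<tau>) * c ^ deg1 p \<le> norm (Pt a \<tau>)"
      by (intro tendsto_le[of "at_right 0"]) auto
    moreover have "0 < norm (poly L \<tau>) * c ^ deg1 p"
      using poly_L_nonzero[OF t] K(2) by (intro mult_pos_pos) auto
    ultimately show False using Pt0 by simp
  qed
  have "c * norm (\<tau> - \<zeta>) powr K \<le> eps1 P Pt \<zeta> \<and> eps1 P Pt \<zeta> \<le> C * norm (\<tau> - \<zeta>) powr K"
    if "norm \<zeta> = 1" "norm (\<zeta> - \<tau>) < \<delta>" for \<zeta>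
  proof (cases "\<zeta> = \<tau>")
    case True
    \<comment> \<open>At \<tau> itself \<open>eps1\<close> is 0 by definition and
      \<open>0 powr K = 0\<close>.\<close>
    then show ?thesis using assms by (simp add: eps1_def)
  next
    case False
    then show ?thesis using K(4)[of \<zeta>] that by (simp add: norm_minus_commute)
  qed
  then have "contact_at P Pt \<tau> K" unfolding contact_at_def using K(1-3) \<open>K > 0\<close> by blast
  then show ?thesis ..
qed

definition contact :: "complex \<Rightarrow> real" where
  "contact \<tau> = (THE K. contact_at P Pt \<tau> K)"

lemma contact_at_contact:
  assumes "\<tau> \<in> S" shows "contact_at P Pt \<tau> (contact \<tau>)"
proof -
  obtain K where K: "contact_at P Pt \<tau> K" using contact_at_exists[OF assms] by blast
  show ?thesis unfolding contact_def
    by (rule theI[of _ K]) (use K contact_at_unique[OF S_norm[OF assms]] in auto)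
qed

text \<open>Replaces the maximum by a condition at each point. Positivity of x covers the
  singularity-free case, where the contact order is 0.\<close>

lemma contact_order_less_iff:
  assumes "x > 0"
  shows "contact_order 1 p < x \<longleftrightarrow> (\<forall>\<tau>\<in>S. contact \<tau> < x)"
proof (cases "sing P = {}")
  case True
  then show ?thesis using assms by (simp add: contact_order_def contact_order1_def)
next
  case False
  then have "contact_order 1 p = Max (contact ` S)"
    by (simp add: contact_order_def contact_order1_def contact_def[abs_def])
  then show ?thesis using False finite_S by simp
qed

text \<open>On the closed disk times the circle, |p~(z, w)| + (1 - |z|) + |w - \<tau>| vanishes only
  at singularities over \<tau>, so it has a positive minimum. At a root over \<zeta> the first term
  is 0 and the third is below half the minimum, which leaves the other half for 1 - |z|.\<close>

lemma eps1_ge_nonsingular: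
  assumes "deg1 p > 0" "norm \<tau> = 1" "\<tau> \<notin> S"
  obtains c where "c > 0"
    "\<And>\<zeta>. norm \<zeta> = 1 \<Longrightarrow> norm (\<zeta> - \<tau>) < c \<Longrightarrow> \<zeta> \<notin> S \<and> c \<le> eps1 P Pt \<zeta>"
proof -
  define f where "f = (\<lambda>(z, w). norm (Pt z w) + (1 - norm z) + norm (w - \<tau>))"
  have cpt: "compact (cball 0 1 \<times> sphere 0 1 :: (complex \<times> complex) set)"
    by (intro compact_Times) auto
  have "continuous_on (cball 0 1 \<times> sphere 0 1) f"
    unfolding f_def case_prod_unfold by (intro continuous_intros)
  moreover have "cball 0 1 \<times> sphere (0::complex) 1 \<noteq> ({} :: (complex \<times> complex) set)"
    using assms(2) by (auto intro!: exI[of _ 0] exI[of _ \<tau>])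
  ultimately obtain zw where zw: "zw \<in> cball 0 1 \<times> sphere 0 1"
      "\<And>y. y \<in> cball 0 1 \<times> sphere 0 1 \<Longrightarrow> f zw \<le> f y"
    using continuous_attains_inf[OF cpt] by blast
  have pos: "f zw > 0"
  proof (rule ccontr)
    assume "\<not> f zw > 0"
    obtain z w where e: "zw = (z, w)" by force
    have n: "norm z \<le> 1" "norm w = 1" using zw(1) e by auto
    have "norm (Pt z w) = 0" "norm z = 1" "norm (w - \<tau>) = 0"
      using \<open>\<not> f zw > 0\<close> n norm_ge_zero[of "Pt z w"] norm_ge_zero[of "w - \<tau>"]
      unfolding e f_def prod.case by linarith+
    then have "(z, \<tau>) \<in> sing P" using norm_P_eq_norm_Pt[of z w] n by (simp add: sing_def)
    then show False using assms(3) by force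
  qed
  have "\<zeta> \<notin> S \<and> f zw / 2 \<le> eps1 P Pt \<zeta>" if z: "norm \<zeta> = 1" "norm (\<zeta> - \<tau>) < f zw / 2" for \<zeta>
  proof
    show nS: "\<zeta> \<notin> S"
    proof
      assume "\<zeta> \<in> S"
      then obtain a where a: "norm a = 1" "P a \<zeta> = 0" by (auto simp: sing_def)
      then have "f (a, \<zeta>) = norm (\<zeta> - \<tau>)" using norm_P_eq_norm_Pt[of a \<zeta>] z by (simp add: f_def)
      moreover have "f zw \<le> f (a, \<zeta>)" using a z by (intro zw(2)) auto
      ultimately show False using z pos by simp
    qed
    obtain as where as: "roots \<zeta> as" using roots_exist z by blast
    obtain x where x: "x \<in> set as" "eps1 P Pt \<zeta> = 1 - norm x"
      using eps1_roots(2)[OF z(1) nS as assms(1)] by blast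
    have "Pt x \<zeta> = 0" using Pt_zero_iff[OF z(1) as] x by blast
    moreover have "f zw \<le> f (x, \<zeta>)" using roots_norm_le[OF z(1) as x(1)] z by (intro zw(2)) auto
    ultimately show "f zw / 2 \<le> eps1 P Pt \<zeta>" using z x by (simp add: f_def)
  qed
  then show ?thesis using that[of "f zw / 2"] pos by auto
qed

end

section \<open>Poisson kernels and integral means\<close>

text \<open>Not normalised: the mass over the circle is 2 pi.\<close>

definition poisson :: "complex \<Rightarrow> complex \<Rightarrow> real" where
  "poisson w z = (1 - (norm w)\<^sup>2) / (norm (z - w))\<^sup>2"

lemma poisson_nonneg: "norm w \<le> 1 \<Longrightarrow> 0 \<le> poisson w z"
  by (simp add: poisson_def power_le_one)

lemma continuous_on_cis_comp [continuous_intros]: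
  "continuous_on A f \<Longrightarrow> continuous_on A (\<lambda>x. cis (f x))"
  unfolding cis_conv_exp by (intro continuous_intros)

text \<open>Cauchy's formula for h, which is g times (1 - |w|^2) / (1 - cnj w z). This factor is 1
  at z = w and turns the Cauchy kernel into the Poisson kernel on the circle.\<close>

lemma poisson_formula:
  assumes cont: "continuous_on (cball 0 1) g" and hol: "g holomorphic_on ball 0 1" and w: "norm w < 1"
  shows "((\<lambda>t. of_real (poisson w (cis t)) * g (cis t)) has_integral 2 * of_real pi * g w) {0..2*pi}"
proof -
  define h where "h z = g z * (of_real (1 - (norm w)\<^sup>2) / (1 - cnj w * z))" for z
  have ne: "1 - cnj w * z \<noteq> 0" if "norm z \<le> 1" for z
    by (rule one_minus_cnj_mult_neq_0[OF w that])
  have "continuous_on (cball 0 1) h" unfolding h_def using ne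
    by (intro continuous_intros cont) auto
  moreover have "h holomorphic_on ball 0 1" unfolding h_def using ne
    by (intro holomorphic_intros hol) auto
  ultimately have "((\<lambda>u. h u / (u - w)) has_contour_integral (2 * of_real pi * \<i> * h w)) (circlepath 0 1)"
    using w by (intro Cauchy_integral_circlepath) auto
  then have "((\<lambda>t. h (cis t) / (cis t - w) * \<i> * cis t) has_integral 2 * of_real pi * \<i> * h w) {0..2*pi}"
    unfolding circlepath_def using has_contour_integral_part_circlepath_iff[of 0 "2 * pi" _ _ 0 1] by simp
  then have "((\<lambda>t. - \<i> * (h (cis t) / (cis t - w) * \<i> * cis t)) has_integral - \<i> * (2 * of_real pi * \<i> * h w)) {0..2*pi}"
    by (rule has_integral_mult_right)
  moreover have "h w = g w"
  proof -
    have "complex_of_real (1 - (norm w)\<^sup>2) = 1 - cnj w * w"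
      by (simp only: of_real_diff of_real_1 complex_norm_square mult.commute)
    then show ?thesis using ne[of w] w by (simp add: h_def)
  qed
  moreover have "- \<i> * (h (cis t) / (cis t - w) * \<i> * cis t) = of_real (poisson w (cis t)) * g (cis t)" for t
  proof -
    let ?z = "cis t"
    have zz: "?z * cnj ?z = 1" by (simp add: cis_mult cis_cnj)
    have e: "1 - cnj w * ?z = ?z * cnj (?z - w)" using zz by (simp add: algebra_simps)
    have n: "complex_of_real ((norm (?z - w))\<^sup>2) = (?z - w) * cnj (?z - w)" by (rule complex_norm_square)
    have "?z - w \<noteq> 0" using w by auto
    then have "cnj (?z - w) \<noteq> 0" by (simp only: complex_cnj_zero_iff not_False_eq_True)
    have gen: "- \<i> * (g ?z * (k / (?z * u)) / v * \<i> * ?z) = k / (v * u) * g ?z" if "u \<noteq> 0" "v \<noteq> 0" for u v k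
      using that by (simp add: field_simps)
    show ?thesis unfolding h_def poisson_def of_real_divide n e
      by (rule gen) fact+
  qed
  ultimately show ?thesis by (simp add: mult_ac)
qed

lemma poisson_has_integral:
  assumes "norm w < 1"
  shows "((\<lambda>t. poisson w (cis t)) has_integral 2 * pi) {0..2*pi}"
proof -
  have "((\<lambda>t. complex_of_real (poisson w (cis t)) * 1) has_integral 2 * of_real pi * 1) {0..2*pi}"
    by (rule poisson_formula[OF _ _ assms]) auto
  from has_integral_Re[OF this] show ?thesis by simp
qed

lemma poisson_nn_integral:
  assumes "norm w < 1"
  shows "(\<integral>\<^sup>+t. ennreal (poisson w (cis t)) * indicator {0..2*pi} t \<partial>lborel) = ennreal (2 * pi)"
  using assms by (intro nn_integral_has_integral_lebesgue' poisson_has_integral poisson_nonneg) auto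

lemma powr_above_tangent:
  fixes x y q :: real
  assumes "x \<ge> 0" "y > 0" "q \<ge> 1"
  shows "y powr q + q * y powr (q - 1) * (x - y) \<le> x powr q"
proof (cases "x = 0")
  case True
  have "y powr q = y powr (q - 1) * y" using assms by (simp add: powr_diff)
  then have "y powr q + q * y powr (q - 1) * (x - y) = (1 - q) * y powr q" by (simp add: True algebra_simps)
  also have "\<dots> \<le> 0" using assms by (intro mult_nonpos_nonneg) auto
  finally show ?thesis using True assms by simp
next
  case False
  then have x: "x > 0" using assms by simp
  have "y \<in> interior {0<..}" using assms by (simp only: interior_open[OF open_greaterThan]) simp
  moreover have "((\<lambda>x. x powr q) has_real_derivative q * y powr (q - 1)) (at y within {0<..})"
    by (rule has_field_derivative_at_within[OF has_real_derivative_powr[OF assms(2)]])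
  ultimately have "q * y powr (q - 1) * (x - y) \<le> x powr q - y powr q"
    using convex_on_imp_above_tangent[OF powr_convex[OF assms(3)] connected_Ioi] x by simp
  then show ?thesis by linarith
qed

text \<open>Jensen's inequality: the tangent line of x powr q at y = |g(w)| is integrated against
  the kernel. Its linear term is nonnegative because |g(w)| is at most the Poisson mean of
  |g|.\<close>

lemma poisson_jensen:
  assumes cont: "continuous_on (cball 0 1) g" and hol: "g holomorphic_on ball 0 1" and w: "norm w < 1"
    and q: "q \<ge> 1"
  shows "ennreal (2 * pi * norm (g w) powr q)
    \<le> (\<integral>\<^sup>+t. ennreal (poisson w (cis t) * norm (g (cis t)) powr q) * indicator {0..2*pi} t \<partial>lborel)"
proof (cases "g w = 0")
  case True
  then show ?thesis by simp
next
  case False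
  define y where "y = norm (g w)"
  have y: "y > 0" using False by (simp add: y_def)
  have cg: "continuous_on {0..2*pi} (\<lambda>t. g (cis t))"
    by (intro continuous_on_compose2[OF cont] continuous_intros) auto
  have cp: "continuous_on {0..2*pi} (\<lambda>t. poisson w (cis t))"
    unfolding poisson_def using w by (intro continuous_intros) auto
  let ?p = "\<lambda>t. poisson w (cis t)"
  have pn: "?p t \<ge> 0" for t using w by (intro poisson_nonneg) simp
  have int1: "(\<lambda>t. ?p t * norm (g (cis t))) integrable_on {0..2*pi}"
    by (intro integrable_continuous_interval continuous_intros cg cp)
  have int2: "(\<lambda>t. ?p t * norm (g (cis t)) powr q) integrable_on {0..2*pi}"
    using q by (intro integrable_continuous_interval continuous_intros cg cp continuous_on_powr') auto
  have "norm (2 * of_real pi * g w) \<le> integral {0..2*pi} (\<lambda>t. ?p t * norm (g (cis t)))"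
  proof -
    have "integral {0..2*pi} (\<lambda>t. of_real (?p t) * g (cis t)) = 2 * of_real pi * g w"
      by (rule integral_unique[OF poisson_formula[OF cont hol w]])
    moreover have "norm (integral {0..2*pi} (\<lambda>t. of_real (?p t) * g (cis t))) \<le> integral {0..2*pi} (\<lambda>t. ?p t * norm (g (cis t)))"
      using pn by (intro integral_norm_bound_integral int1 has_integral_integrable[OF poisson_formula[OF cont hol w]])
        (auto simp: norm_mult)
    ultimately show ?thesis by simp
  qed
  then have lower: "2 * pi * y \<le> integral {0..2*pi} (\<lambda>t. ?p t * norm (g (cis t)))"
    by (simp add: norm_mult y_def)
  have lin: "((\<lambda>t. ?p t * (y powr q) + q * y powr (q - 1) * (?p t * norm (g (cis t)) - ?p t * y)) has_integral
     2 * pi * (y powr q) + q * y powr (q - 1) * (integral {0..2*pi} (\<lambda>t. ?p t * norm (g (cis t))) - 2 * pi * y)) {0..2*pi}"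
    by (intro has_integral_add has_integral_mult_left has_integral_mult_right has_integral_diff
        poisson_has_integral[OF w] integrable_integral int1)
  have "2 * pi * (y powr q) \<le> 2 * pi * (y powr q) + q * y powr (q - 1) * (integral {0..2*pi} (\<lambda>t. ?p t * norm (g (cis t))) - 2 * pi * y)"
    using lower q by simp
  also have "\<dots> \<le> integral {0..2*pi} (\<lambda>t. ?p t * norm (g (cis t)) powr q)"
  proof (rule has_integral_le[OF lin integrable_integral[OF int2]])
    fix t
    have "?p t * (y powr q + q * y powr (q - 1) * (norm (g (cis t)) - y)) \<le> ?p t * norm (g (cis t)) powr q"
      using y q by (intro mult_left_mono powr_above_tangent pn) auto
    then show "?p t * (y powr q) + q * y powr (q - 1) * (?p t * norm (g (cis t)) - ?p t * y) \<le> ?p t * norm (g (cis t)) powr q"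
      by (simp add: algebra_simps)
  qed
  finally have "ennreal (2 * pi * y powr q) \<le> ennreal (integral {0..2*pi} (\<lambda>t. ?p t * norm (g (cis t)) powr q))"
    by (rule ennreal_leI)
  also have "\<dots> = (\<integral>\<^sup>+t. ennreal (?p t * norm (g (cis t)) powr q) * indicator {0..2*pi} t \<partial>lborel)"
    using pn by (intro nn_integral_has_integral_lebesgue'[symmetric] integrable_integral int2) auto
  finally show ?thesis by (simp add: y_def)
qed

text \<open>After Fubini this lets the integral over t be read as the mass of a single
  kernel.\<close>

lemma poisson_symmetric:
  "poisson (of_real r * cis t) (cis s) = poisson (of_real r * cis s) (cis t)"
proof -
  have "cis s - of_real r * cis t = cis s * cis t * cnj (cis t - of_real r * cis s)"
    by (simp add: algebra_simps cis_mult cis_cnj)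
  then have "norm (cis s - of_real r * cis t) = norm (cis t - of_real r * cis s)"
    by (simp only: norm_mult norm_cis complex_mod_cnj mult_1)
  then show ?thesis by (simp add: poisson_def norm_mult)
qed

lemma borel_measurable_cis [measurable]: "cis \<in> borel_measurable borel"
  by (intro borel_measurable_continuous_onI continuous_intros)

text \<open>\<open>poisson_jensen\<close> at w = r e^(it), integrated over t; by Fubini and symmetry
  each boundary point receives the total mass 2 pi, which cancels.\<close>

lemma integral_mean_le_boundary:
  assumes cont: "continuous_on (cball 0 1) g" and hol: "g holomorphic_on ball 0 1"
    and r: "0 < r" "r < 1" and q: "q \<ge> 1"
  shows "(\<integral>\<^sup>+t. ennreal (norm (g (of_real r * cis t)) powr q) * indicator {0..2*pi} t \<partial>lborel)
       \<le> (\<integral>\<^sup>+s. ennreal (norm (g (cis s)) powr q) * indicator {0..2*pi} s \<partial>lborel)"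
proof -
  let ?I = "indicator {0..2*pi} :: real \<Rightarrow> ennreal"
  have nr: "norm (of_real r * cis t) < 1" for t using r by (simp add: norm_mult)
  have cg: "continuous_on UNIV (\<lambda>t. g (cis t))"
    by (intro continuous_on_compose2[OF cont] continuous_intros) auto
  have gm [measurable]: "(\<lambda>t. g (cis t)) \<in> borel_measurable borel"
    by (rule borel_measurable_continuous_onI[OF cg])
  have pm [measurable]: "(\<lambda>x. poisson (of_real r * cis (f x)) (cis (h x))) \<in> borel_measurable M"
    if [measurable]: "f \<in> borel_measurable M" "h \<in> borel_measurable M" for f h and M :: "'a measure"
    unfolding poisson_def by measurable
  have pn: "0 \<le> poisson (of_real r * cis t) z" for t z
    using nr by (intro poisson_nonneg less_imp_le)
  have "(\<integral>\<^sup>+t. ennreal (2 * pi) * (ennreal (norm (g (of_real r * cis t)) powr q) * ?I t) \<partial>lborel)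
    \<le> (\<integral>\<^sup>+t. (\<integral>\<^sup>+s. ennreal (poisson (of_real r * cis t) (cis s) * norm (g (cis s)) powr q) * ?I s * ?I t \<partial>lborel) \<partial>lborel)"
  proof (rule nn_integral_mono)
    fix t
    have "ennreal (2 * pi) * (ennreal (norm (g (of_real r * cis t)) powr q) * ?I t)
      = ennreal (2 * pi * norm (g (of_real r * cis t)) powr q) * ?I t"
      by (simp add: ennreal_mult mult.assoc)
    also have "\<dots> \<le> (\<integral>\<^sup>+s. ennreal (poisson (of_real r * cis t) (cis s) * norm (g (cis s)) powr q) * ?I s \<partial>lborel) * ?I t"
      by (intro mult_right_mono poisson_jensen cont hol nr q) auto
    also have "\<dots> = (\<integral>\<^sup>+s. ennreal (poisson (of_real r * cis t) (cis s) * norm (g (cis s)) powr q) * ?I s * ?I t \<partial>lborel)"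
      by (rule nn_integral_multc[symmetric]) measurable
    finally show "ennreal (2 * pi) * (ennreal (norm (g (of_real r * cis t)) powr q) * ?I t) \<le>
      (\<integral>\<^sup>+s. ennreal (poisson (of_real r * cis t) (cis s) * norm (g (cis s)) powr q) * ?I s * ?I t \<partial>lborel)" .
  qed
  also have "\<dots> = (\<integral>\<^sup>+s. (\<integral>\<^sup>+t. ennreal (poisson (of_real r * cis t) (cis s) * norm (g (cis s)) powr q) * ?I s * ?I t \<partial>lborel) \<partial>lborel)"
    by (rule lborel_pair.Fubini') measurable
  also have "\<dots> = (\<integral>\<^sup>+s. ennreal (2 * pi) * (ennreal (norm (g (cis s)) powr q) * ?I s) \<partial>lborel)"
  proof (rule nn_integral_cong)
    fix s
    have "(\<integral>\<^sup>+t. ennreal (poisson (of_real r * cis t) (cis s) * norm (g (cis s)) powr q) * ?I s * ?I t \<partial>lborel)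
      = (\<integral>\<^sup>+t. (ennreal (poisson (of_real r * cis s) (cis t)) * ?I t) * (ennreal (norm (g (cis s)) powr q) * ?I s) \<partial>lborel)"
    proof (rule nn_integral_cong)
      fix t
      have "poisson (of_real r * cis t) (cis s) = poisson (of_real r * cis s) (cis t)"
        by (rule poisson_symmetric)
      moreover have "ennreal (poisson (of_real r * cis s) (cis t) * norm (g (cis s)) powr q)
        = ennreal (poisson (of_real r * cis s) (cis t)) * ennreal (norm (g (cis s)) powr q)"
        by (intro ennreal_mult pn) auto
      ultimately show "ennreal (poisson (of_real r * cis t) (cis s) * norm (g (cis s)) powr q) * ?I s * ?I t
        = (ennreal (poisson (of_real r * cis s) (cis t)) * ?I t) * (ennreal (norm (g (cis s)) powr q) * ?I s)"
        by (simp only: mult_ac)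
    qed
    also have "\<dots> = (\<integral>\<^sup>+t. ennreal (poisson (of_real r * cis s) (cis t)) * ?I t \<partial>lborel) * (ennreal (norm (g (cis s)) powr q) * ?I s)"
      by (rule nn_integral_multc) measurable
    also have "\<dots> = ennreal (2 * pi) * (ennreal (norm (g (cis s)) powr q) * ?I s)"
      by (simp only: poisson_nn_integral[OF nr])
    finally show "(\<integral>\<^sup>+t. ennreal (poisson (of_real r * cis t) (cis s) * norm (g (cis s)) powr q) * ?I s * ?I t \<partial>lborel)
      = ennreal (2 * pi) * (ennreal (norm (g (cis s)) powr q) * ?I s)" .
  qed
  also have "\<dots> = ennreal (2 * pi) * (\<integral>\<^sup>+s. ennreal (norm (g (cis s)) powr q) * ?I s \<partial>lborel)"
    by (rule nn_integral_cmult) measurable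
  also have "(\<integral>\<^sup>+t. ennreal (2 * pi) * (ennreal (norm (g (of_real r * cis t)) powr q) * ?I t) \<partial>lborel)
     = ennreal (2 * pi) * (\<integral>\<^sup>+t. ennreal (norm (g (of_real r * cis t)) powr q) * ?I t \<partial>lborel)"
  proof (rule nn_integral_cmult)
    have "continuous_on UNIV (\<lambda>t. g (of_real r * cis t))"
      using less_imp_le[OF nr] by (intro continuous_on_compose2[OF cont] continuous_intros) auto
    then have [measurable]: "(\<lambda>t. g (of_real r * cis t)) \<in> borel_measurable borel"
      by (rule borel_measurable_continuous_onI)
    show "(\<lambda>t. ennreal (norm (g (of_real r * cis t)) powr q) * ?I t) \<in> borel_measurable lborel"
      by measurable
  qed
  finally show ?thesis
    by (subst (asm) ennreal_mult_le_mult_iff) auto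
qed

section \<open>Power integrals near a point\<close>

lemma nn_integral_abs_powr_finite:
  assumes "e < 1" "d > 0"
  shows "(\<integral>\<^sup>+t. ennreal (\<bar>t - t0\<bar> powr (-e)) * indicator {t0 - d..t0 + d} t \<partial>lborel) < \<infinity>"
proof -
  let ?f = "\<lambda>t::real. ennreal (t powr (-e)) * indicator {0..d} t"
  have fin: "integral\<^sup>N lborel ?f < \<infinity>"
    using assms by (subst nn_integral_has_integral_lebesgue'[OF _ has_integral_powr_from_0]) auto
  have "(\<integral>\<^sup>+t. ennreal (\<bar>t - t0\<bar> powr (-e)) * indicator {t0 - d..t0 + d} t \<partial>lborel)
    \<le> (\<integral>\<^sup>+t. ?f (- t0 + 1 * t) + ?f (t0 + (-1) * t) \<partial>lborel)"
    by (rule nn_integral_mono) (auto simp: indicator_def abs_if)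
  also have "\<dots> = (\<integral>\<^sup>+t. ?f (- t0 + 1 * t) \<partial>lborel) + (\<integral>\<^sup>+t. ?f (t0 + (-1) * t) \<partial>lborel)"
    by (rule nn_integral_add) measurable
  also have "(\<integral>\<^sup>+t. ?f (- t0 + 1 * t) \<partial>lborel) = integral\<^sup>N lborel ?f"
    using nn_integral_real_affine[of ?f 1 "-t0"] by simp
  also have "(\<integral>\<^sup>+t. ?f (t0 + (-1) * t) \<partial>lborel) = integral\<^sup>N lborel ?f"
    using nn_integral_real_affine[of ?f "-1" t0] by simp
  finally show ?thesis using fin by (auto simp: less_top[symmetric] top_unique)
qed

lemma nn_integral_powr_infinite:
  assumes "e \<ge> 1" "0 < d"
  shows "(\<integral>\<^sup>+t. ennreal ((t - t0) powr (-e)) * indicator {t0<..t0 + d} t \<partial>lborel) = \<infinity>"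
proof -
  \<comment> \<open>Distances at most 1 are needed for 1 / x to lie below x powr (-e).\<close>
  define d' where "d' = min d 1"
  have d': "0 < d'" "d' \<le> 1" "d' \<le> d" using assms by (auto simp: d'_def)
  have "ennreal (real n) \<le> (\<integral>\<^sup>+t. ennreal ((t - t0) powr (-e)) * indicator {t0<..t0 + d} t \<partial>lborel)" for n
  proof -
    \<comment> \<open>Chosen so that 1 / x integrated from a to d' gives exactly n.\<close>
    define a where "a = d' * exp (- real n)"
    have a: "0 < a" "a \<le> d'" using d' by (auto simp: a_def)
    have "((\<lambda>t. 1 / (t - t0)) has_integral (ln (t0 + d' - t0) - ln (t0 + a - t0))) {t0 + a..t0 + d'}"
      using a by (intro fundamental_theorem_of_calculus)
        (auto intro!: derivative_eq_intros simp flip: has_real_derivative_iff_has_vector_derivative)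
    moreover have "ln (t0 + d' - t0) - ln (t0 + a - t0) = real n"
      using d' by (simp add: a_def ln_mult)
    ultimately have "((\<lambda>t. 1 / (t - t0)) has_integral real n) {t0 + a..t0 + d'}" by simp
    then have "ennreal (real n) = (\<integral>\<^sup>+t. ennreal (1 / (t - t0)) * indicator {t0 + a..t0 + d'} t \<partial>lborel)"
      using a by (intro nn_integral_has_integral_lebesgue'[symmetric]) auto
    also have "\<dots> \<le> (\<integral>\<^sup>+t. ennreal ((t - t0) powr (-e)) * indicator {t0<..t0 + d} t \<partial>lborel)"
    proof (rule nn_integral_mono)
      fix t
      show "ennreal (1 / (t - t0)) * indicator {t0 + a..t0 + d'} t \<le> ennreal ((t - t0) powr (-e)) * indicator {t0<..t0 + d} t"
      proof (cases "t \<in> {t0 + a..t0 + d'}")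
        case True
        then have t: "0 < t - t0" "t - t0 \<le> 1" "t \<le> t0 + d" using a d' by auto
        have "1 / (t - t0) = (t - t0) powr (-1)" using t by (simp add: powr_minus_divide)
        also have "\<dots> \<le> (t - t0) powr (-e)" using t assms by (intro powr_mono') auto
        finally show ?thesis using True t by (auto simp: indicator_def intro!: ennreal_leI)
      qed auto
    qed
    finally show ?thesis .
  qed
  then show ?thesis
    by (metis infinity_ennreal_def linorder_not_le neq_top_trans
        ennreal_Ex_less_of_nat ennreal_of_nat_eq_real_of_nat)
qed

section \<open>Boundary behaviour of the derivative\<close>

lemma norm_cis_diff: "norm (cis t - cis t0) = 2 * \<bar>sin ((t - t0) / 2)\<bar>"
proof -
  have "cis t = cis t0 * cis (t - t0)" by (simp add: cis_mult)
  then show ?thesis using norm_circle_diff[of "cis t0" "t - t0"] by simp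
qed

lemma norm_cis_diff_le: "norm (cis t - cis t0) \<le> \<bar>t - t0\<bar>"
  using abs_sin_x_le_abs_x[of "(t - t0) / 2"] unfolding norm_cis_diff by simp

lemma norm_cis_diff_ge:
  assumes "\<bar>t - t0\<bar> \<le> 1" shows "\<bar>t - t0\<bar> / 2 \<le> norm (cis t - cis t0)"
proof -
  have sin_ge: "y / 2 \<le> sin y" if y: "0 < y" "y \<le> 1 / 2" for y :: real
  proof -
    obtain z where z: "0 < z" "z < y" "sin y - sin 0 = (y - 0) * cos z"
      using MVT2[of 0 y sin cos] y by auto
    have "z \<le> pi / 3" using z y pi_gt3 by simp
    then have "cos (pi / 3) \<le> cos z" using z pi_gt3 by (intro cos_monotone_0_pi_le) auto
    then have "y * (1 / 2) \<le> y * cos z" using y by (intro mult_left_mono) (auto simp: cos_60)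
    then show ?thesis using z by simp
  qed
  define y where "y = \<bar>t - t0\<bar> / 2"
  have "y = (t - t0) / 2 \<or> y = - ((t - t0) / 2)" by (auto simp: y_def abs_if)
  then have "\<bar>sin ((t - t0) / 2)\<bar> = \<bar>sin y\<bar>" by (metis abs_minus_cancel sin_minus)
  moreover have "y / 2 \<le> \<bar>sin y\<bar>"
  proof (cases "y = 0")
    case False
    then have "y / 2 \<le> sin y" using assms by (intro sin_ge) (auto simp: y_def)
    then show ?thesis by linarith
  qed simp
  ultimately show ?thesis unfolding norm_cis_diff by (simp add: y_def)
qed

lemma borel_measurable_eval2 [measurable]:
  assumes [measurable]: "f \<in> borel_measurable M" "g \<in> borel_measurable M"
  shows "(\<lambda>x. eval2 p (f x) (g x)) \<in> borel_measurable M"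
  unfolding eval2_as_sum by measurable

lemma holomorphic_on_eval2_1: "(\<lambda>w. eval2 p w b) holomorphic_on A"
  unfolding eval2_as_sum by (intro holomorphic_intros)

lemma holomorphic_on_eval2_2: "(\<lambda>w. eval2 p a w) holomorphic_on A"
  unfolding eval2_as_sum by (intro holomorphic_intros)

lemma blaschke_eq_divide: "blaschke as z = (\<Prod>a\<leftarrow>as. z - a) / (\<Prod>a\<leftarrow>as. 1 - cnj a * z)"
  unfolding blaschke_def by (induction as) auto

section \<open>The z1-derivative on slices over the circle\<close>

context stable_poly begin

text \<open>The quotient rule written out instead of \<open>deriv\<close>: it is measurable
  everywhere and meaningful at boundary points, with value 0 where P vanishes.\<close>

definition F :: "complex \<Rightarrow> complex \<Rightarrow> complex" where
  "F a b = (eval2 (pderiv (reflect2 p)) a b * P a b - Pt a b * eval2 (pderiv p) a b) / (P a b)\<^sup>2"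

lemma has_field_derivative_F:
  assumes "P a b \<noteq> 0"
  shows "((\<lambda>w. Pt w b / P w b) has_field_derivative F a b) (at a)"
  unfolding F_def power2_eq_square using assms
  by (intro DERIV_divide has_field_derivative_eval2)

lemma partial_eq_F:
  assumes "P a b \<noteq> 0"
  shows "partial 1 (\<lambda>z1 z2. Pt z1 z2 / P z1 z2) a b = F a b"
  using DERIV_imp_deriv[OF has_field_derivative_F[OF assms]] by (simp add: partial_def)

lemma borel_measurable_F [measurable]:
  assumes [measurable]: "f \<in> borel_measurable M" "g \<in> borel_measurable M"
  shows "(\<lambda>x. F (f x) (g x)) \<in> borel_measurable M"
  unfolding F_def by measurable

lemma continuous_on_F:
  assumes "continuous_on A f" "continuous_on A g" "\<And>x. x \<in> A \<Longrightarrow> P (f x) (g x) \<noteq> 0"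
  shows "continuous_on A (\<lambda>x. F (f x) (g x))"
  unfolding F_def using assms by (intro continuous_intros) auto

text \<open>Over b the quotient Pt / P is u times a Blaschke product, with u = L(b) / P(0, b)
  unimodular.\<close>

lemma F_blaschke:
  assumes "norm b = 1" "b \<notin> S" "roots b as" "norm z \<le> 1"
  shows "norm (F z b) \<le> (\<Sum>a\<leftarrow>as. (1 - (norm a)\<^sup>2) / (norm (1 - cnj a * z))\<^sup>2)"
    and "norm z = 1 \<Longrightarrow> norm (F z b) = (\<Sum>a\<leftarrow>as. poisson a z)"
proof -
  define u where "u = poly L b / P 0 b"
  have u: "norm u = 1"
    using norm_poly_L[OF assms(1)] nonzero_disk_circle[of 0 b] assms(1) by (simp add: u_def norm_divide)
  have r: "\<forall>a\<in>set as. norm a < 1" using roots_norm_less[OF assms(1-3)] by blast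
  have eq: "Pt w b / P w b = u * blaschke as w" for w
    by (simp add: Pt_roots[OF assms(3)] P_roots[OF assms(1,3), of w] blaschke_eq_divide u_def)
  obtain D where D: "(blaschke as has_field_derivative D) (at z)"
    "norm D \<le> (\<Sum>a\<leftarrow>as. (1 - (norm a)\<^sup>2) / (norm (1 - cnj a * z))\<^sup>2)"
    "norm z = 1 \<longrightarrow> norm (blaschke as z) = 1 \<and>
       z * D = blaschke as z * of_real (\<Sum>a\<leftarrow>as. (1 - (norm a)\<^sup>2) / (norm (z - a))\<^sup>2)"
    using blaschke_derivative[OF r assms(4)] by blast
  have "((\<lambda>w. Pt w b / P w b) has_field_derivative u * D) (at z)"
    unfolding eq by (rule DERIV_cmult[OF D(1)])
  then have F: "F z b = u * D"
    using has_field_derivative_F[OF nonzero_cdisk_circle[OF assms(4,1,2)]] DERIV_unique by blast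
  show "norm (F z b) \<le> (\<Sum>a\<leftarrow>as. (1 - (norm a)\<^sup>2) / (norm (1 - cnj a * z))\<^sup>2)"
    using D(2) by (simp add: F norm_mult u)
  show "norm (F z b) = (\<Sum>a\<leftarrow>as. poisson a z)" if z: "norm z = 1"
  proof -
    have D3: "norm (blaschke as z) = 1"
      "z * D = blaschke as z * of_real (\<Sum>a\<leftarrow>as. (1 - (norm a)\<^sup>2) / (norm (z - a))\<^sup>2)"
      using D(3) z by auto
    have "norm (F z b) = norm (z * D)" by (simp add: F norm_mult u z)
    also have "\<dots> = \<bar>\<Sum>a\<leftarrow>as. poisson a z\<bar>"
      unfolding D3(2) norm_mult D3(1) norm_of_real poisson_def by simp
    also have "\<dots> = (\<Sum>a\<leftarrow>as. poisson a z)"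
      using r by (intro abs_of_nonneg sum_list_nonneg) (auto intro!: poisson_nonneg simp: less_imp_le)
    finally show ?thesis .
  qed
qed

text \<open>The integral is at most the supremum to the power q - 1 times the L1 norm. |F| is
  dominated by the Poisson kernels at the shrunken roots r a, since |1 - cnj a r e^(is)| = |e^(is) -
  r a|; their total mass is 2 pi m. Neither bound depends on r.\<close>

lemma circle_integral_F_le:
  assumes "norm b = 1" "b \<notin> S" "deg1 p > 0" "0 < r" "r < 1" "q \<ge> 1"
  shows "(\<integral>\<^sup>+s. ennreal (norm (F (of_real r * cis s) b) powr q) * indicator {0..2*pi} s \<partial>lborel)
    \<le> ennreal ((2 * real (deg1 p)) powr (q - 1) * (2 * pi * real (deg1 p)) * (1 / eps1 P Pt b) powr (q - 1))"
proof -
  obtain as where as: "roots b as" using roots_exist[OF assms(1)] .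
  have len: "length as = deg1 p" using as by (simp add: roots_def)
  let ?e = "eps1 P Pt b"
  note e = eps1_roots[OF assms(1,2) as assms(3)]
  \<comment> \<open>Each factor contributes at most (1 - |a|^2) / (1 - |a|)^2 = (1 + |a|) / (1 -
    |a|) <= 2 / eps1.\<close>
  define M where "M = real (deg1 p) * (2 / ?e)"
  have r1: "norm a < 1" if "a \<in> set as" for a using roots_norm_less[OF assms(1,2) as that] .
  have ra: "norm (of_real r * a) < 1" if "a \<in> set as" for a
    using r1[OF that] assms(4,5) mult_left_le_one_le[of "norm a" r] by (simp add: norm_mult)
  let ?S = "\<lambda>s. \<Sum>a\<leftarrow>as. poisson (of_real r * a) (cis s)"
  have pt: "norm (F (of_real r * cis s) b) powr q \<le> M powr (q - 1) * ?S s" for s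
  proof -
    let ?z = "of_real r * cis s"
    have z: "norm ?z \<le> 1" using assms(4,5) by (simp add: norm_mult)
    have b1: "norm (F ?z b) \<le> ?S s"
    proof (rule order_trans[OF F_blaschke(1)[OF assms(1,2) as z]], rule sum_list_mono)
      fix a assume a: "a \<in> set as"
      have "norm (1 - cnj a * ?z) = norm (1 - cnj (of_real r * a) * cis s)" by (simp add: mult_ac)
      also have "\<dots> = norm (cis s - of_real r * a)" by (rule norm_one_minus_cnj_mult) simp
      finally have n: "norm (1 - cnj a * ?z) = norm (cis s - of_real r * a)" .
      have "(norm (of_real r * a))\<^sup>2 \<le> (norm a)\<^sup>2"
        using assms(4,5) by (intro power_mono) (auto simp: norm_mult mult_left_le_one_le)
      then show "(1 - (norm a)\<^sup>2) / (norm (1 - cnj a * ?z))\<^sup>2 \<le> poisson (of_real r * a) (cis s)"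
        unfolding n poisson_def by (intro divide_right_mono) auto
    qed
    have "norm (F ?z b) \<le> (\<Sum>a\<leftarrow>as. 2 / ?e)"
    proof (rule order_trans[OF F_blaschke(1)[OF assms(1,2) as z]], rule sum_list_mono)
      fix a assume a: "a \<in> set as"
      have "norm (cnj a * ?z) \<le> norm a" using z
        by (simp add: norm_mult mult_left_le)
      then have ge: "1 - norm a \<le> norm (1 - cnj a * ?z)"
        using norm_triangle_ineq2[of 1 "cnj a * ?z"] by simp
      then have pos: "0 < norm (1 - cnj a * ?z)" using r1[OF a] by linarith
      from ge have "(1 - norm a)\<^sup>2 \<le> (norm (1 - cnj a * ?z))\<^sup>2" using r1[OF a] by (intro power_mono) auto
      then have "(1 - (norm a)\<^sup>2) / (norm (1 - cnj a * ?z))\<^sup>2 \<le> (1 - (norm a)\<^sup>2) / (1 - norm a)\<^sup>2"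
        using r1[OF a] pos by (intro divide_left_mono mult_pos_pos zero_less_power) (auto simp: power_le_one)
      also have "\<dots> = ((1 - norm a) * (1 + norm a)) / ((1 - norm a) * (1 - norm a))"
        by (simp add: power2_eq_square algebra_simps)
      also have "\<dots> = (1 + norm a) / (1 - norm a)"
        using r1[OF a] by (intro mult_divide_mult_cancel_left) simp
      also have "\<dots> \<le> 2 / ?e" using r1[OF a] e(1,3) a by (intro frac_le) auto
      finally show "(1 - (norm a)\<^sup>2) / (norm (1 - cnj a * ?z))\<^sup>2 \<le> 2 / ?e" .
    qed
    then have b2: "norm (F ?z b) \<le> M" by (simp add: M_def len sum_list_triv)
    show ?thesis
    proof (cases "F ?z b = 0")
      case True
      then show ?thesis using b1 by simp
    next
      case False
      have "norm (F ?z b) powr q = norm (F ?z b) powr (q - 1) * norm (F ?z b)"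
        using False by (simp add: powr_diff)
      also have "\<dots> \<le> M powr (q - 1) * ?S s"
        using b1 b2 assms(6) by (intro mult_mono powr_mono2) auto
      finally show ?thesis .
    qed
  qed
  have hi: "((\<lambda>s. \<Sum>a\<leftarrow>xs. poisson (of_real r * a) (cis s)) has_integral real (length xs) * (2 * pi)) {0..2*pi}"
    if "set xs \<subseteq> set as" for xs
    using that
  proof (induction xs)
    case (Cons a xs)
    then have "((\<lambda>s. poisson (of_real r * a) (cis s) + (\<Sum>a\<leftarrow>xs. poisson (of_real r * a) (cis s)))
      has_integral (2 * pi + real (length xs) * (2 * pi))) {0..2*pi}"
      using ra by (intro has_integral_add poisson_has_integral) auto
    then show ?case by (simp add: algebra_simps)
  qed simp
  have "((\<lambda>s. M powr (q - 1) * ?S s) has_integral M powr (q - 1) * (real (length as) * (2 * pi))) {0..2*pi}"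
    by (intro has_integral_mult_right hi order_refl)
  then have "(\<integral>\<^sup>+s. ennreal (M powr (q - 1) * ?S s) * indicator {0..2*pi} s \<partial>lborel)
     = ennreal (M powr (q - 1) * (real (length as) * (2 * pi)))"
    using ra by (intro nn_integral_has_integral_lebesgue')
      (auto intro!: mult_nonneg_nonneg sum_list_nonneg poisson_nonneg simp: less_imp_le)
  moreover have "(\<integral>\<^sup>+s. ennreal (norm (F (of_real r * cis s) b) powr q) * indicator {0..2*pi} s \<partial>lborel)
     \<le> (\<integral>\<^sup>+s. ennreal (M powr (q - 1) * ?S s) * indicator {0..2*pi} s \<partial>lborel)"
    using pt by (intro nn_integral_mono mult_right_mono ennreal_leI) auto
  moreover have "M powr (q - 1) = (2 * real (deg1 p)) powr (q - 1) * (1 / ?e) powr (q - 1)"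
    using e(3) by (simp add: M_def mult.commute flip: powr_mult)
  ultimately show ?thesis by (simp add: len mult_ac)
qed

text \<open>Let x be a closest root and e = 1 - |x|. On an arc of length e at its angle the distance
  to x is at most 2 e, so the kernel of x alone is at least e / (2 e)^2 = 1 / (4 e), and the arc
  contributes (1 / (4 e))^q e.\<close>

lemma circle_integral_F_ge:
  assumes "norm b = 1" "b \<notin> S" "deg1 p > 0" "q \<ge> 1"
  shows "ennreal ((1 / 4) powr q * eps1 P Pt b powr (1 - q))
    \<le> (\<integral>\<^sup>+s. ennreal (norm (F (cis s) b) powr q) * indicator {0..2*pi} s \<partial>lborel)"
proof -
  obtain as where as: "roots b as" using roots_exist[OF assms(1)] .
  define e where "e = eps1 P Pt b"
  note e = eps1_roots[OF assms(1,2) as assms(3), folded e_def]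
  obtain x where x: "x \<in> set as" "e = 1 - norm x" using e(2) by blast
  define \<theta> where "\<theta> = Arg2pi x"
  have th: "0 \<le> \<theta>" "\<theta> < 2 * pi" "x = of_real (norm x) * cis \<theta>"
    using Arg2pi[of x] by (auto simp: \<theta>_def is_Arg_def cis_conv_exp)
  \<comment> \<open>The arc lies after \<theta>, or before it if it would overrun 2 pi; e <= 1 keeps
    it inside [0, 2 pi].\<close>
  define c where "c = (if \<theta> + e \<le> 2 * pi then \<theta> else \<theta> - e)"
  have c: "{c..c + e} \<subseteq> {0..2*pi}" "\<And>s. s \<in> {c..c + e} \<Longrightarrow> \<bar>s - \<theta>\<bar> \<le> e"
    using th(1,2) e(3,4) pi_gt3 by (auto simp: c_def split: if_splits)
  have r1: "norm a < 1" if "a \<in> set as" for a using roots_norm_less[OF assms(1,2) as that] .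
  have ge: "1 / (4 * e) \<le> norm (F (cis s) b)" if s: "s \<in> {c..c + e}" for s
  proof -
    have "norm (cis s - x) \<le> norm (cis s - cis \<theta>) + norm (cis \<theta> - x)" by norm
    also have "norm (cis \<theta> - x) = norm (of_real (1 - norm x) * cis \<theta>)"
      by (subst th(3)) (simp add: algebra_simps)
    also have "\<dots> = e" using r1[OF x(1)] x(2) by (simp only: norm_mult norm_cis norm_of_real) simp
    also have "norm (cis s - cis \<theta>) \<le> e" using norm_cis_diff_le[of s \<theta>] c(2)[OF s] by linarith
    finally have "norm (cis s - x) \<le> 2 * e" by simp
    then have n: "(norm (cis s - x))\<^sup>2 \<le> (2 * e)\<^sup>2" by (intro power_mono) auto
    have "cis s \<noteq> x" using r1[OF x(1)] by (metis norm_cis order_less_irrefl)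
    then have pos: "0 < (norm (cis s - x))\<^sup>2" by simp
    have "1 / (4 * e) = e / (2 * e)\<^sup>2" using e(3) by (simp add: power2_eq_square)
    also have "\<dots> \<le> (1 - (norm x)\<^sup>2) / (norm (cis s - x))\<^sup>2"
    proof (rule frac_le)
      have "norm x * norm x \<le> norm x * 1" using r1[OF x(1)] by (intro mult_left_mono) auto
      then show "e \<le> 1 - (norm x)\<^sup>2" by (simp add: x(2) power2_eq_square)
    qed (use e(3) n pos r1[OF x(1)] in \<open>auto simp: power_le_one\<close>)
    also have "\<dots> = poisson x (cis s)" by (simp add: poisson_def)
    also have "\<dots> \<le> (\<Sum>a\<leftarrow>as. poisson a (cis s))"
      using x r1 by (intro member_le_sum_list) (auto intro!: poisson_nonneg simp: less_imp_le)
    also have "\<dots> = norm (F (cis s) b)" by (rule F_blaschke(2)[OF assms(1,2) as, symmetric]) auto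
    finally show ?thesis .
  qed
  have "(1 / 4) powr q * e powr (1 - q) = (1 / (4 * e)) powr q * e"
    using e(3) by (simp add: powr_diff powr_divide powr_mult)
  then have "ennreal ((1 / 4) powr q * e powr (1 - q)) = ennreal ((1 / (4 * e)) powr q) * emeasure lborel {c..c + e}"
    using e(3) by (simp add: ennreal_mult)
  also have "\<dots> = (\<integral>\<^sup>+s. ennreal ((1 / (4 * e)) powr q) * indicator {c..c + e} s \<partial>lborel)"
    by (simp add: nn_integral_cmult_indicator)
  also have "\<dots> \<le> (\<integral>\<^sup>+s. ennreal (norm (F (cis s) b) powr q) * indicator {0..2*pi} s \<partial>lborel)"
  proof (rule nn_integral_mono)
    fix s
    show "ennreal ((1 / (4 * e)) powr q) * indicator {c..c + e} s \<le> ennreal (norm (F (cis s) b) powr q) * indicator {0..2*pi} s"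
    proof (cases "s \<in> {c..c + e}")
      case True
      then have "(1 / (4 * e)) powr q \<le> norm (F (cis s) b) powr q"
        using ge[OF True] e(3) assms(4) by (intro powr_mono2) auto
      then show ?thesis using True c(1) by (auto simp: indicator_def intro!: ennreal_leI)
    qed auto
  qed
  finally show ?thesis by (simp add: e_def)
qed

section \<open>Integrability of 1 / eps1 to the power q - 1 in the angular variable\<close>

text \<open>Exponent 0 off the singular coordinates puts both cases in one form for the compactness
  argument. The point t0 is excluded since \<open>eps1\<close> may be 0 there.\<close>

lemma eps1_ge_powr:
  assumes "deg1 p > 0"
  shows "\<exists>d c. d > 0 \<and> c > 0 \<and> (\<forall>t. 0 < \<bar>t - t0\<bar> \<longrightarrow> \<bar>t - t0\<bar> < d \<longrightarrow>
    cis t \<notin> S \<and> c * \<bar>t - t0\<bar> powr (if cis t0 \<in> S then contact (cis t0) else 0) \<le> eps1 P Pt (cis t))"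
proof (cases "cis t0 \<in> S")
  case True
  define K where "K = contact (cis t0)"
  have "contact_at P Pt (cis t0) K" unfolding K_def by (rule contact_at_contact[OF True])
  then obtain d c where d: "K > 0" "d > 0" "c > 0"
    "\<And>\<zeta>. norm \<zeta> = 1 \<Longrightarrow> norm (\<zeta> - cis t0) < d \<Longrightarrow> c * norm (cis t0 - \<zeta>) powr K \<le> eps1 P Pt \<zeta>"
    unfolding contact_at_def by metis
  have "cis t \<notin> S \<and> c * (1 / 2) powr K * \<bar>t - t0\<bar> powr K \<le> eps1 P Pt (cis t)"
    if t: "0 < \<bar>t - t0\<bar>" "\<bar>t - t0\<bar> < min d 1" for t
  proof -
    have l: "\<bar>t - t0\<bar> / 2 \<le> norm (cis t - cis t0)" using t by (intro norm_cis_diff_ge) simp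
    have "norm (cis t - cis t0) < d" using norm_cis_diff_le[of t t0] t by simp
    then have "c * norm (cis t0 - cis t) powr K \<le> eps1 P Pt (cis t)" by (intro d(4)) auto
    moreover have "(\<bar>t - t0\<bar> / 2) powr K \<le> norm (cis t0 - cis t) powr K"
      using l d(1) by (intro powr_mono2) (auto simp: norm_minus_commute)
    ultimately have 1: "c * (\<bar>t - t0\<bar> / 2) powr K \<le> eps1 P Pt (cis t)"
      using d(3) by (meson mult_left_mono less_imp_le order_trans)
    moreover have "0 < c * (\<bar>t - t0\<bar> / 2) powr K" using d(3) t by (intro mult_pos_pos) auto
    ultimately have "0 < eps1 P Pt (cis t)" by linarith
    then have "cis t \<notin> S" by (metis eps1_def less_irrefl)
    then show ?thesis using 1 by (simp add: powr_divide)
  qed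
  moreover have "c * (1 / 2) powr K > 0" using d(3) by simp
  ultimately show ?thesis using True d(2) unfolding K_def[symmetric] if_P[OF True]
    by (intro exI[of _ "min d 1"] exI[of _ "c * (1 / 2) powr K"]) auto
next
  case False
  then obtain c where c: "c > 0"
    "\<And>\<zeta>. norm \<zeta> = 1 \<Longrightarrow> norm (\<zeta> - cis t0) < c \<Longrightarrow> \<zeta> \<notin> S \<and> c \<le> eps1 P Pt \<zeta>"
    using eps1_ge_nonsingular[OF assms, of "cis t0"] by (metis norm_cis)
  have "cis t \<notin> S \<and> c * \<bar>t - t0\<bar> powr 0 \<le> eps1 P Pt (cis t)"
    if "0 < \<bar>t - t0\<bar>" "\<bar>t - t0\<bar> < c" for t
    using c(2)[of "cis t"] norm_cis_diff_le[of t t0] that by simp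
  then show ?thesis using c(1) False by auto
qed

lemma inverse_eps1_le_powr:
  assumes "deg1 p > 0" "q \<ge> 1" "\<forall>\<tau>\<in>S. contact \<tau> * (q - 1) < 1"
  shows "\<exists>d C e. d > 0 \<and> e < 1 \<and> C \<ge> 0 \<and> (\<forall>t. 0 < \<bar>t - t0\<bar> \<longrightarrow> \<bar>t - t0\<bar> < d \<longrightarrow>
    cis t \<notin> S \<and> (1 / eps1 P Pt (cis t)) powr (q - 1) \<le> C * \<bar>t - t0\<bar> powr (-e))"
proof -
  define K where "K = (if cis t0 \<in> S then contact (cis t0) else 0)"
  obtain d c where d: "d > 0" "c > 0" "\<And>t. 0 < \<bar>t - t0\<bar> \<Longrightarrow> \<bar>t - t0\<bar> < d \<Longrightarrow>
    cis t \<notin> S \<and> c * \<bar>t - t0\<bar> powr K \<le> eps1 P Pt (cis t)"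
    using eps1_ge_powr[OF assms(1), of t0] unfolding K_def by metis
  have e: "K * (q - 1) < 1" using assms(3) by (auto simp: K_def)
  have "(1 / eps1 P Pt (cis t)) powr (q - 1) \<le> (1 / c) powr (q - 1) * \<bar>t - t0\<bar> powr (- (K * (q - 1)))"
    if t: "0 < \<bar>t - t0\<bar>" "\<bar>t - t0\<bar> < d" for t
  proof -
    have pos: "0 < c * \<bar>t - t0\<bar> powr K" using d(2) t by (intro mult_pos_pos) auto
    then have ep: "eps1 P Pt (cis t) > 0" using d(3)[OF t] by linarith
    have "(1 / eps1 P Pt (cis t)) powr (q - 1) \<le> (1 / (c * \<bar>t - t0\<bar> powr K)) powr (q - 1)"
      using d(3)[OF t] pos ep assms(2) by (intro powr_mono2 frac_le) auto
    also have "1 / (c * \<bar>t - t0\<bar> powr K) = (1 / c) * \<bar>t - t0\<bar> powr (- K)"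
      by (simp add: powr_minus_divide)
    also have "\<dots> powr (q - 1) = (1 / c) powr (q - 1) * (\<bar>t - t0\<bar> powr (- K)) powr (q - 1)"
      using d(2) by (intro powr_mult)
    also have "(\<bar>t - t0\<bar> powr (- K)) powr (q - 1) = \<bar>t - t0\<bar> powr (- (K * (q - 1)))"
      by (simp add: powr_powr)
    finally show ?thesis .
  qed
  then show ?thesis using d e
    by (intro exI[of _ d] exI[of _ "(1 / c) powr (q - 1)"] exI[of _ "K * (q - 1)"]) auto
qed

text \<open>Finitely many local power bounds cover [0, 2 pi] by compactness; V is their sum and T
  the finite set of centres. An explicit V avoids any question of measurability of
  \<open>eps1\<close>.\<close>

lemma inverse_eps1_majorant:
  assumes "deg1 p > 0" "q \<ge> 1" "\<forall>\<tau>\<in>S. contact \<tau> * (q - 1) < 1"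
  shows "\<exists>V T. (V :: real \<Rightarrow> real) \<in> borel_measurable borel \<and> finite T \<and>
    (\<integral>\<^sup>+t. ennreal (V t) * indicator {0..2*pi} t \<partial>lborel) < \<infinity> \<and>
    (\<forall>t. t \<in> {0..2*pi} \<longrightarrow> t \<notin> T \<longrightarrow> cis t \<notin> S \<and> (1 / eps1 P Pt (cis t)) powr (q - 1) \<le> V t)"
proof -
  obtain d C e where d: "\<And>t0. d t0 > (0::real)" "\<And>t0. e t0 < (1::real)" "\<And>t0. C t0 \<ge> (0::real)"
    "\<And>t0 t. 0 < \<bar>t - t0\<bar> \<Longrightarrow> \<bar>t - t0\<bar> < d t0 \<Longrightarrow>
    cis t \<notin> S \<and> (1 / eps1 P Pt (cis t)) powr (q - 1) \<le> C t0 * \<bar>t - t0\<bar> powr (- e t0)"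
    using inverse_eps1_le_powr[OF assms] by metis
  have "{0..2*pi} \<subseteq> (\<Union>t0\<in>{0..2*pi}. ball t0 (d t0))" using d(1) by force
  then obtain T where T: "T \<subseteq> {0..2*pi}" "finite T" "{0..2*pi} \<subseteq> (\<Union>t0\<in>T. ball t0 (d t0))"
    using compactE_image[of "{0..2*pi}" "{0..2*pi}" "\<lambda>t0. ball t0 (d t0)"] by auto
  define V where "V t = (\<Sum>t0\<in>T. C t0 * \<bar>t - t0\<bar> powr (- e t0))" for t
  have 1: "V \<in> borel_measurable borel" unfolding V_def by measurable
  have "(\<integral>\<^sup>+t. ennreal (V t) * indicator {0..2*pi} t \<partial>lborel)
    = (\<Sum>t0\<in>T. \<integral>\<^sup>+t. ennreal (C t0) * (ennreal (\<bar>t - t0\<bar> powr (- e t0)) * indicator {0..2*pi} t) \<partial>lborel)"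
  proof (subst nn_integral_sum[symmetric])
    have "ennreal (V t) = (\<Sum>t0\<in>T. ennreal (C t0) * ennreal (\<bar>t - t0\<bar> powr (- e t0)))" for t
      unfolding V_def using d(3) by (simp add: ennreal_mult flip: sum_ennreal)
    then show "(\<integral>\<^sup>+t. ennreal (V t) * indicator {0..2*pi} t \<partial>lborel)
      = (\<integral>\<^sup>+t. (\<Sum>t0\<in>T. ennreal (C t0) * (ennreal (\<bar>t - t0\<bar> powr (- e t0)) * indicator {0..2*pi} t)) \<partial>lborel)"
      by (simp add: sum_distrib_right mult.assoc)
  qed auto
  also have "\<dots> < \<infinity>"
  proof -
    have "(\<integral>\<^sup>+t. ennreal (C t0) * (ennreal (\<bar>t - t0\<bar> powr (- e t0)) * indicator {0..2*pi} t) \<partial>lborel) < \<infinity>"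
      if "t0 \<in> T" for t0
    proof -
      have "(\<integral>\<^sup>+t. ennreal (\<bar>t - t0\<bar> powr (- e t0)) * indicator {0..2*pi} t \<partial>lborel)
        \<le> (\<integral>\<^sup>+t. ennreal (\<bar>t - t0\<bar> powr (- e t0)) * indicator {t0 - 2*pi..t0 + 2*pi} t \<partial>lborel)"
        using that T(1) by (intro nn_integral_mono mult_left_mono) (auto simp: indicator_def)
      also have "\<dots> < \<infinity>" by (rule nn_integral_abs_powr_finite[OF d(2)]) simp
      finally show ?thesis by (subst nn_integral_cmult) (auto simp: ennreal_mult_less_top)
    qed
    then show ?thesis using T(2) by simp
  qed
  finally have 2: "(\<integral>\<^sup>+t. ennreal (V t) * indicator {0..2*pi} t \<partial>lborel) < \<infinity>" .
  have "cis t \<notin> S \<and> (1 / eps1 P Pt (cis t)) powr (q - 1) \<le> V t" if t: "t \<in> {0..2*pi}" "t \<notin> T" for t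
  proof -
    obtain t0 where t0: "t0 \<in> T" "\<bar>t - t0\<bar> < d t0"
      using T(3) t(1) by (force simp: dist_real_def abs_minus_commute)
    then have "0 < \<bar>t - t0\<bar>" using t(2) by auto
    note * = d(4)[OF this t0(2)]
    moreover have "C t0 * \<bar>t - t0\<bar> powr (- e t0) \<le> V t"
      unfolding V_def using t0 T(2) d(3) by (intro member_le_sum) auto
    ultimately show ?thesis by linarith
  qed
  with 1 2 T(2) show ?thesis by blast
qed

end

section \<open>Integrals over the torus\<close>

lemma nn_integral_square:
  fixes f :: "real \<times> real \<Rightarrow> ennreal"
  assumes [measurable]: "f \<in> borel_measurable borel"
  shows "(\<integral>\<^sup>+x. f x * indicator ({0..2*pi} \<times> {0..2*pi}) x \<partial>lborel)
    = (\<integral>\<^sup>+s. (\<integral>\<^sup>+t. f (s, t) * indicator {0..2*pi} t \<partial>lborel) * indicator {0..2*pi} s \<partial>lborel)"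
    and "(\<integral>\<^sup>+x. f x * indicator ({0..2*pi} \<times> {0..2*pi}) x \<partial>lborel)
    = (\<integral>\<^sup>+t. (\<integral>\<^sup>+s. f (s, t) * indicator {0..2*pi} s \<partial>lborel) * indicator {0..2*pi} t \<partial>lborel)"
proof -
  let ?g = "\<lambda>x. f x * indicator ({0..2*pi} \<times> {0..2*pi}) x"
  have [measurable]: "f \<in> borel_measurable (borel \<Otimes>\<^sub>M borel)"
    using assms by (simp add: borel_prod)
  have m: "?g \<in> borel_measurable (lborel \<Otimes>\<^sub>M lborel)" by measurable
  have "integral\<^sup>N lborel ?g = (\<integral>\<^sup>+s. \<integral>\<^sup>+t. ?g (s, t) \<partial>lborel \<partial>lborel)"
    unfolding lborel_prod[symmetric] by (rule lborel.nn_integral_fst[OF m, symmetric])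
  also have "\<dots> = (\<integral>\<^sup>+s. (\<integral>\<^sup>+t. f (s, t) * indicator {0..2*pi} t \<partial>lborel) * indicator {0..2*pi} s \<partial>lborel)"
    by (subst nn_integral_multc[symmetric]) (simp_all add: indicator_times mult_ac)
  finally show "integral\<^sup>N lborel ?g
    = (\<integral>\<^sup>+s. (\<integral>\<^sup>+t. f (s, t) * indicator {0..2*pi} t \<partial>lborel) * indicator {0..2*pi} s \<partial>lborel)" .
  have "integral\<^sup>N lborel ?g = (\<integral>\<^sup>+t. \<integral>\<^sup>+s. ?g (s, t) \<partial>lborel \<partial>lborel)"
    unfolding lborel_prod[symmetric] by (rule lborel_pair.nn_integral_snd[OF m, symmetric])
  also have "\<dots> = (\<integral>\<^sup>+t. (\<integral>\<^sup>+s. f (s, t) * indicator {0..2*pi} s \<partial>lborel) * indicator {0..2*pi} t \<partial>lborel)"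
    by (subst nn_integral_multc[symmetric]) (simp_all add: indicator_times mult_ac)
  finally show "integral\<^sup>N lborel ?g
    = (\<integral>\<^sup>+t. (\<integral>\<^sup>+s. f (s, t) * indicator {0..2*pi} s \<partial>lborel) * indicator {0..2*pi} t \<partial>lborel)" .
qed

definition torus_integral :: "real \<Rightarrow> (complex \<Rightarrow> complex \<Rightarrow> complex) \<Rightarrow> real \<Rightarrow> ennreal" where
  "torus_integral q f r = (\<integral>\<^sup>+ x. ennreal (norm (f (r * cis (fst x)) (r * cis (snd x))) powr q)
          * indicator ({0..2*pi} \<times> {0..2*pi}) x \<partial>lborel)"

lemma hardy2_iff_bounded:
  "hardy2 q f \<longleftrightarrow> holo_bidisk f \<and> (\<exists>M. M < \<infinity> \<and> (\<forall>r\<in>{0<..<1}. torus_integral q f r \<le> M))"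
proof -
  let ?c = "ennreal (4 * pi\<^sup>2)"
  have c: "?c \<noteq> 0" "?c \<noteq> top" by auto
  have "(SUP r\<in>{0<..<1}. torus_integral q f r / ?c) < \<infinity> \<longleftrightarrow> (\<exists>M. M < \<infinity> \<and> (\<forall>r\<in>{0<..<1}. torus_integral q f r \<le> M))"
  proof
    assume "(SUP r\<in>{0<..<1}. torus_integral q f r / ?c) < \<infinity>"
    moreover have "torus_integral q f r \<le> (SUP r\<in>{0<..<1}. torus_integral q f r / ?c) * ?c"
      if "r \<in> {0<..<1}" for r
    proof -
      have "torus_integral q f r = torus_integral q f r / ?c * ?c"
        using c by (simp add: ennreal_divide_times mult_divide_eq_ennreal)
      also have "\<dots> \<le> (SUP r\<in>{0<..<1}. torus_integral q f r / ?c) * ?c"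
        using that by (intro mult_right_mono SUP_upper) auto
      finally show ?thesis .
    qed
    ultimately show "\<exists>M. M < \<infinity> \<and> (\<forall>r\<in>{0<..<1}. torus_integral q f r \<le> M)"
      by (intro exI[of _ "(SUP r\<in>{0<..<1}. torus_integral q f r / ?c) * ?c"])
        (auto simp: ennreal_mult_less_top)
  next
    assume "\<exists>M. M < \<infinity> \<and> (\<forall>r\<in>{0<..<1}. torus_integral q f r \<le> M)"
    then obtain M where M: "M < \<infinity>" "\<forall>r\<in>{0<..<1}. torus_integral q f r \<le> M" by blast
    have "(SUP r\<in>{0<..<1}. torus_integral q f r / ?c) \<le> M / ?c"
      using M(2) by (intro SUP_least divide_right_mono_ennreal) auto
    also have "\<dots> < \<infinity>" using M(1) c unfolding infinity_ennreal_def less_top[symmetric]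
      by (auto simp: ennreal_divide_eq_top_iff)
    finally show "(SUP r\<in>{0<..<1}. torus_integral q f r / ?c) < \<infinity>" .
  qed
  then show ?thesis unfolding hardy2_def torus_integral_def by simp
qed

section \<open>The Hardy condition for the z1-derivative\<close>

context stable_poly begin

abbreviation phi1 where "phi1 \<equiv> partial 1 (\<lambda>z1 z2. Pt z1 z2 / P z1 z2)"

lemma torus_integral_phi1:
  assumes "0 < r" "r < 1"
  shows "torus_integral q phi1 r = torus_integral q F r"
proof -
  have "phi1 (r * cis s) (r * cis t) = F (r * cis s) (r * cis t)" for s t
    using assms by (intro partial_eq_F no_zeros) (simp_all add: norm_mult)
  then show ?thesis by (simp add: torus_integral_def)
qed

lemma holo_bidisk_phi1: "holo_bidisk phi1"
proof -
  have eq: "phi1 a b = F a b" if "norm a < 1" "norm b < 1" for a b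
    using that by (intro partial_eq_F no_zeros)
  have "(\<lambda>w. phi1 w b) holomorphic_on ball 0 1" if "b \<in> ball 0 1" for b
  proof (rule holomorphic_transform)
    show "(\<lambda>w. F w b) holomorphic_on ball 0 1"
      unfolding F_def using no_zeros that by (intro holomorphic_intros holomorphic_on_eval2_1) auto
  qed (use eq that in auto)
  moreover have "(\<lambda>w. phi1 a w) holomorphic_on ball 0 1" if "a \<in> ball 0 1" for a
  proof (rule holomorphic_transform)
    show "(\<lambda>w. F a w) holomorphic_on ball 0 1"
      unfolding F_def using no_zeros that by (intro holomorphic_intros holomorphic_on_eval2_2) auto
  qed (use eq that in auto)
  ultimately show ?thesis unfolding holo_bidisk_def by blast
qed

text \<open>For |z1| = r < 1 the function F(z1, .) is continuous on the closed disk, since P has no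
  zero on the open disk times the closed disk; so the integral means in z2 can be compared with the
  circle. The order is then exchanged to make z1 the inner variable.\<close>

lemma torus_integral_le_half_boundary:
  assumes "0 < r" "r < 1" "q \<ge> 1"
  shows "torus_integral q F r \<le> (\<integral>\<^sup>+t. (\<integral>\<^sup>+s. ennreal (norm (F (r * cis s) (cis t)) powr q)
      * indicator {0..2*pi} s \<partial>lborel) * indicator {0..2*pi} t \<partial>lborel)"
proof -
  let ?I = "indicator {0..2*pi} :: real \<Rightarrow> ennreal"
  have nr: "norm (r * cis s) < 1" for s using assms by (simp add: norm_mult)
  have m: "(\<lambda>x. ennreal (norm (F (r * cis (fst x)) (cis (snd x))) powr q)) \<in> borel_measurable borel"
    unfolding borel_prod[symmetric] by measurable
  have m': "(\<lambda>x. ennreal (norm (F (r * cis (fst x)) (r * cis (snd x))) powr q)) \<in> borel_measurable borel"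
    unfolding borel_prod[symmetric] by measurable
  have "torus_integral q F r = (\<integral>\<^sup>+s. (\<integral>\<^sup>+t. ennreal (norm (F (r * cis s) (r * cis t)) powr q) * ?I t \<partial>lborel) * ?I s \<partial>lborel)"
    unfolding torus_integral_def
    by (subst nn_integral_square(1)[OF m']) simp
  also have "\<dots> \<le> (\<integral>\<^sup>+s. (\<integral>\<^sup>+t. ennreal (norm (F (r * cis s) (cis t)) powr q) * ?I t \<partial>lborel) * ?I s \<partial>lborel)"
  proof (rule nn_integral_mono, rule mult_right_mono)
    fix s
    have nz: "P (r * cis s) w \<noteq> 0" if "norm w \<le> 1" for w by (rule nonzero_disk_cdisk[OF nr that])
    show "(\<integral>\<^sup>+t. ennreal (norm (F (r * cis s) (r * cis t)) powr q) * ?I t \<partial>lborel)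
      \<le> (\<integral>\<^sup>+t. ennreal (norm (F (r * cis s) (cis t)) powr q) * ?I t \<partial>lborel)"
    proof (rule integral_mean_le_boundary[OF _ _ assms])
      show "continuous_on (cball 0 1) (F (r * cis s))"
        using continuous_on_F[of "cball 0 1" "\<lambda>w. r * cis s" "\<lambda>w. w"] nz by (auto intro!: continuous_intros)
      show "F (r * cis s) holomorphic_on ball 0 1"
        unfolding F_def[abs_def] using nz by (intro holomorphic_intros holomorphic_on_eval2_2) auto
    qed
  qed auto
  also have "\<dots> = (\<integral>\<^sup>+x. ennreal (norm (F (r * cis (fst x)) (cis (snd x))) powr q) * indicator ({0..2*pi} \<times> {0..2*pi}) x \<partial>lborel)"
    by (subst nn_integral_square(1)[OF m]) simp
  also have "\<dots> = (\<integral>\<^sup>+t. (\<integral>\<^sup>+s. ennreal (norm (F (r * cis s) (cis t)) powr q) * ?I s \<partial>lborel) * ?I t \<partial>lborel)"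
    by (subst nn_integral_square(2)[OF m]) simp
  finally show ?thesis .
qed

lemma torus_integral_bounded:
  assumes "deg1 p > 0" "q \<ge> 1" "\<forall>\<tau>\<in>S. contact \<tau> * (q - 1) < 1"
  shows "\<exists>M. M < \<infinity> \<and> (\<forall>r\<in>{0<..<1}. torus_integral q F r \<le> M)"
proof -
  let ?I = "indicator {0..2*pi} :: real \<Rightarrow> ennreal"
  obtain V T where V: "V \<in> borel_measurable borel" "finite T"
    "(\<integral>\<^sup>+t. ennreal (V t) * ?I t \<partial>lborel) < \<infinity>"
    "\<forall>t. t \<in> {0..2*pi} \<longrightarrow> t \<notin> T \<longrightarrow> cis t \<notin> S \<and> (1 / eps1 P Pt (cis t)) powr (q - 1) \<le> V t"
    using inverse_eps1_majorant[OF assms] by blast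
  note [measurable] = V(1)
  define C where "C = (2 * real (deg1 p)) powr (q - 1) * (2 * pi * real (deg1 p))"
  have C: "C \<ge> 0" by (simp add: C_def)
  have "torus_integral q F r \<le> ennreal C * (\<integral>\<^sup>+t. ennreal (V t) * ?I t \<partial>lborel)" if r: "0 < r" "r < 1" for r
  proof -
    have "AE t in lborel. t \<notin> T" using V(2) by (intro AE_not_in finite_imp_null_set_lborel)
    then have ae: "AE t in lborel. (\<integral>\<^sup>+s. ennreal (norm (F (r * cis s) (cis t)) powr q) * ?I s \<partial>lborel) * ?I t
       \<le> ennreal C * (ennreal (V t) * ?I t)"
    proof eventually_elim
      case (elim t)
      show ?case
      proof (cases "t \<in> {0..2*pi}")
        case True
        then have t: "cis t \<notin> S" "(1 / eps1 P Pt (cis t)) powr (q - 1) \<le> V t" using V(4) elim by auto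
        have "(\<integral>\<^sup>+s. ennreal (norm (F (r * cis s) (cis t)) powr q) * ?I s \<partial>lborel)
          \<le> ennreal (C * (1 / eps1 P Pt (cis t)) powr (q - 1))"
          unfolding C_def by (rule circle_integral_F_le[OF _ t(1) assms(1) r assms(2)]) simp
        also have "\<dots> \<le> ennreal (C * V t)" using t C by (intro ennreal_leI mult_left_mono)
        also have "\<dots> = ennreal C * ennreal (V t)" using C by (rule ennreal_mult')
        finally show ?thesis using True by simp
      qed simp
    qed
    have "torus_integral q F r \<le> (\<integral>\<^sup>+t. (\<integral>\<^sup>+s. ennreal (norm (F (r * cis s) (cis t)) powr q)
      * ?I s \<partial>lborel) * ?I t \<partial>lborel)"
      by (rule torus_integral_le_half_boundary[OF r assms(2)])
    also have "\<dots> \<le> (\<integral>\<^sup>+t. ennreal C * (ennreal (V t) * ?I t) \<partial>lborel)"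
      by (rule nn_integral_mono_AE[OF ae])
    also have "\<dots> = ennreal C * (\<integral>\<^sup>+t. ennreal (V t) * ?I t \<partial>lborel)"
      by (rule nn_integral_cmult) measurable
    finally show ?thesis .
  qed
  moreover have "ennreal C * (\<integral>\<^sup>+t. ennreal (V t) * ?I t \<partial>lborel) < \<infinity>"
    using V(3) by (simp add: ennreal_mult_less_top)
  ultimately show ?thesis by auto
qed

text \<open>Fatou's lemma along radii increasing to 1 bounds the boundary integral by M. The slice
  estimate makes it at least a multiple of the integral of (t - t0) powr (-K (q - 1)), which
  diverges.\<close>

lemma torus_integral_unbounded:
  assumes "q \<ge> 1" "\<tau> \<in> S" "contact \<tau> * (q - 1) \<ge> 1" and M: "\<forall>r\<in>{0<..<1}. torus_integral q F r \<le> M"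
  shows "M = \<infinity>"
proof -
  let ?I = "indicator {0..2*pi} :: real \<Rightarrow> ennreal"
  let ?Q = "indicator ({0..2*pi} \<times> {0..2*pi}) :: real \<times> real \<Rightarrow> ennreal"
  have deg: "deg1 p > 0" using S_empty_of_deg1_0 assms(2) by blast
  define K where "K = contact \<tau>"
  have "contact_at P Pt \<tau> K" unfolding K_def by (rule contact_at_contact[OF assms(2)])
  then obtain d c C where d: "K > 0" "d > 0" "c > 0" "C > 0"
    "\<forall>\<zeta>. norm \<zeta> = 1 \<and> norm (\<zeta> - \<tau>) < d \<longrightarrow>
       c * norm (\<tau> - \<zeta>) powr K \<le> eps1 P Pt \<zeta> \<and> eps1 P Pt \<zeta> \<le> C * norm (\<tau> - \<zeta>) powr K"
    unfolding contact_at_def by blast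
  define t0 where "t0 = Arg2pi \<tau>"
  have t0: "0 \<le> t0" "t0 < 2 * pi" "\<tau> = cis t0"
    using Arg2pi[of \<tau>] S_norm[OF assms(2)] by (auto simp: t0_def is_Arg_def cis_conv_exp)
  \<comment> \<open>Keeps the interval to the right of t0 inside [0, 2 pi], within reach of the
    contact estimate and short enough to compare chord and angle. One side of t0 already gives
    divergence.\<close>
  define \<delta> where "\<delta> = min (min (d / 2) 1) (2 * pi - t0)"
  have \<delta>: "\<delta> > 0" "\<delta> < d" "\<delta> \<le> 1" "t0 + \<delta> \<le> 2 * pi" using d(2) t0 by (auto simp: \<delta>_def)
  \<comment> \<open>The constant of \<open>circle_integral_F_ge\<close> times the effect of eps1 <=
    C |t - t0|^K under the nonincreasing power 1 - q.\<close>
  define k where "k = (1 / 4) powr q * C powr (1 - q)"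
  have k: "k > 0" using d(4) by (simp add: k_def)
  define r where "r n = 1 - 1 / real (n + 2)" for n :: nat
  have r: "r n \<in> {0<..<1}" for n by (auto simp: r_def field_simps)
  have rlim: "r \<longlonglongrightarrow> 1"
  proof -
    have "(\<lambda>n. 1 - 1 / real (n + 2)) \<longlonglongrightarrow> 1 - 0"
      by (intro tendsto_intros LIMSEQ_ignore_initial_segment[OF lim_1_over_n])
    then show ?thesis by (simp add: r_def[abs_def])
  qed
  define u where "u n x = ennreal (norm (F (r n * cis (fst x)) (r n * cis (snd x))) powr q)" for n and x :: "real \<times> real"
  have um [measurable]: "u n \<in> borel_measurable borel" for n unfolding u_def borel_prod[symmetric] by measurable
  have lim: "(\<lambda>n. u n (s, t)) \<longlonglongrightarrow> ennreal (norm (F (cis s) (cis t)) powr q)" if "cis t \<notin> S" for s t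
  proof -
    have nz: "P (cis s) (cis t) \<noteq> 0" using that by (intro nonzero_cdisk_circle) auto
    have ev: "(\<lambda>n. eval2 h (r n * cis s) (r n * cis t)) \<longlonglongrightarrow> eval2 h (of_real 1 * cis s) (of_real 1 * cis t)" for h
      unfolding eval2_as_sum by (intro tendsto_intros rlim)
    have "(\<lambda>n. F (r n * cis s) (r n * cis t)) \<longlonglongrightarrow> F (cis s) (cis t)"
      unfolding F_def using ev nz by (intro tendsto_intros) auto
    then show ?thesis unfolding u_def fst_conv snd_conv
      using assms(1) by (intro tendsto_ennrealI tendsto_powr' tendsto_norm tendsto_const) auto
  qed
  \<comment> \<open>Measurable as a lower limit, and equal to the boundary value of |F|^q whenever
    \<open>cis t\<close> is outside S.\<close>
  define U where "U x = liminf (\<lambda>n. u n x)" for x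
  have Um [measurable]: "U \<in> borel_measurable borel" unfolding U_def by measurable
  have "(\<integral>\<^sup>+x. U x * ?Q x \<partial>lborel) \<le> (\<integral>\<^sup>+x. liminf (\<lambda>n. u n x * ?Q x) \<partial>lborel)"
    by (intro nn_integral_mono) (auto simp: U_def indicator_def split: prod.splits)
  also have "\<dots> \<le> liminf (\<lambda>n. \<integral>\<^sup>+x. u n x * ?Q x \<partial>lborel)"
  proof (rule nn_integral_liminf)
    have [measurable]: "({0..2*pi} \<times> {0..2*pi} :: (real \<times> real) set) \<in> sets borel"
      by (intro borel_closed closed_Times) auto
    show "(\<lambda>x. u n x * ?Q x) \<in> borel_measurable lborel" for n
      by (rule borel_measurable_times_ennreal) (simp_all add: borel_measurable_indicator)
  qed
  also have "\<dots> \<le> liminf (\<lambda>n. M)"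
    using M r unfolding torus_integral_def u_def by (intro Liminf_mono always_eventually) auto
  also have "\<dots> = M" by (simp add: Liminf_const)
  finally have le: "(\<integral>\<^sup>+x. U x * ?Q x \<partial>lborel) \<le> M" .
  have "\<infinity> = ennreal k * (\<integral>\<^sup>+t. ennreal ((t - t0) powr (- (K * (q - 1)))) * indicator {t0<..t0 + \<delta>} t \<partial>lborel)"
    using assms(3) \<delta>(1) k by (subst nn_integral_powr_infinite) (auto simp: K_def ennreal_mult_top)
  also have "\<dots> = (\<integral>\<^sup>+t. ennreal k * (ennreal ((t - t0) powr (- (K * (q - 1)))) * indicator {t0<..t0 + \<delta>} t) \<partial>lborel)"
    by (rule nn_integral_cmult[symmetric]) measurable
  also have "\<dots> \<le> (\<integral>\<^sup>+t. (\<integral>\<^sup>+s. U (s, t) * ?I s \<partial>lborel) * ?I t \<partial>lborel)"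
  proof (rule nn_integral_mono)
    fix t
    show "ennreal k * (ennreal ((t - t0) powr (- (K * (q - 1)))) * indicator {t0<..t0 + \<delta>} t)
      \<le> (\<integral>\<^sup>+s. U (s, t) * ?I s \<partial>lborel) * ?I t"
    proof (cases "t \<in> {t0<..t0 + \<delta>}")
      case True
      then have t: "0 < t - t0" "t - t0 \<le> \<delta>" "t \<in> {0..2*pi}" using t0 \<delta> by auto
      have nl: "norm (cis t - \<tau>) \<le> t - t0" using norm_cis_diff_le[of t t0] t by (simp add: t0(3))
      have nh: "(t - t0) / 2 \<le> norm (cis t - cis t0)" using norm_cis_diff_ge[of t t0] t \<delta>(3) by simp
      have ng: "0 < norm (cis t - \<tau>)" unfolding t0(3)
        by (rule less_le_trans[OF _ nh]) (use t(1) in simp)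
      have e: "c * norm (\<tau> - cis t) powr K \<le> eps1 P Pt (cis t)" "eps1 P Pt (cis t) \<le> C * norm (\<tau> - cis t) powr K"
        using d(5) nl t(2) \<delta>(2) by auto
      have ep: "0 < eps1 P Pt (cis t)"
      proof -
        have "0 < c * norm (\<tau> - cis t) powr K" using d(3) ng by (simp add: norm_minus_commute)
        then show ?thesis using e(1) by linarith
      qed
      then have nS: "cis t \<notin> S" by (metis eps1_def less_irrefl)
      have "norm (\<tau> - cis t) powr K \<le> (t - t0) powr K"
        using nl d(1) by (intro powr_mono2) (auto simp: norm_minus_commute)
      then have "eps1 P Pt (cis t) \<le> C * (t - t0) powr K" using e(2) d(4)
        by (meson mult_left_mono less_imp_le order_trans)
      then have "(C * (t - t0) powr K) powr (1 - q) \<le> eps1 P Pt (cis t) powr (1 - q)"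
        using ep assms(1) by (intro powr_mono2') auto
      moreover have "(C * (t - t0) powr K) powr (1 - q) = C powr (1 - q) * (t - t0) powr (- (K * (q - 1)))"
        using d(4) t by (simp add: powr_mult powr_powr algebra_simps)
      ultimately have "(1 / 4) powr q * (C powr (1 - q) * (t - t0) powr (- (K * (q - 1)))) \<le> (1 / 4) powr q * eps1 P Pt (cis t) powr (1 - q)"
        by (intro mult_left_mono) auto
      then have "ennreal (k * (t - t0) powr (- (K * (q - 1)))) \<le> ennreal ((1 / 4) powr q * eps1 P Pt (cis t) powr (1 - q))"
        by (intro ennreal_leI) (simp add: k_def mult.assoc)
      also have "\<dots> \<le> (\<integral>\<^sup>+s. ennreal (norm (F (cis s) (cis t)) powr q) * ?I s \<partial>lborel)"
        by (rule circle_integral_F_ge[OF _ nS deg assms(1)]) simp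
      also have "\<dots> = (\<integral>\<^sup>+s. U (s, t) * ?I s \<partial>lborel)"
        using lim_imp_Liminf[OF sequentially_bot lim[OF nS]] by (simp add: U_def)
      finally show ?thesis using True t k by (simp add: ennreal_mult)
    qed simp
  qed
  also have "\<dots> = (\<integral>\<^sup>+x. U x * ?Q x \<partial>lborel)"
    by (rule nn_integral_square(2)[symmetric]) measurable
  also note le
  finally show ?thesis by (simp add: top_unique)
qed

lemma F_eq_0_of_deg1_0:
  assumes "deg1 p = 0" shows "F a b = 0"
proof -
  have "degree p = 0" "degree (reflect2 p) = 0"
    using assms degree_reflect2_le[of p] by (auto simp: deg1_def)
  then have "pderiv p = 0" "pderiv (reflect2 p) = 0" by (auto elim!: degree_eq_zeroE simp: pderiv_pCons)
  then show ?thesis by (simp add: F_def)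
qed

lemma hardy2_phi1_iff_contact:
  assumes "q \<ge> 1"
  shows "hardy2 q phi1 \<longleftrightarrow> (\<forall>\<tau>\<in>S. contact \<tau> * (q - 1) < 1)"
proof -
  have "hardy2 q phi1 \<longleftrightarrow> (\<exists>M. M < \<infinity> \<and> (\<forall>r\<in>{0<..<1}. torus_integral q F r \<le> M))"
    unfolding hardy2_iff_bounded by (simp add: holo_bidisk_phi1 torus_integral_phi1 del: One_nat_def)
  also have "\<dots> \<longleftrightarrow> (\<forall>\<tau>\<in>S. contact \<tau> * (q - 1) < 1)"
  proof
    assume "\<exists>M. M < \<infinity> \<and> (\<forall>r\<in>{0<..<1}. torus_integral q F r \<le> M)"
    then obtain M where M: "M < \<infinity>" "\<forall>r\<in>{0<..<1}. torus_integral q F r \<le> M" by blast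
    show "\<forall>\<tau>\<in>S. contact \<tau> * (q - 1) < 1"
    proof (intro ballI, rule ccontr)
      fix \<tau> assume "\<tau> \<in> S" "\<not> contact \<tau> * (q - 1) < 1"
      then have "M = \<infinity>" using M(2) by (intro torus_integral_unbounded[OF assms]) auto
      then show False using M(1) by simp
    qed
  next
    assume R: "\<forall>\<tau>\<in>S. contact \<tau> * (q - 1) < 1"
    show "\<exists>M. M < \<infinity> \<and> (\<forall>r\<in>{0<..<1}. torus_integral q F r \<le> M)"
    proof (cases "deg1 p = 0")
      case True
      then show ?thesis using assms by (intro exI[of _ 0]) (simp add: torus_integral_def F_eq_0_of_deg1_0)
    qed (use torus_integral_bounded assms R in blast)
  qed
  finally show ?thesis .
qed

lemma hardy2_phi1_iff:
  assumes "q \<ge> 1"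
  shows "hardy2 q phi1 \<longleftrightarrow> (q = 1 \<or> contact_order 1 p < 1 / (q - 1))"
proof (cases "q = 1")
  case True
  then show ?thesis using hardy2_phi1_iff_contact[OF assms] by simp
next
  case False
  then have "q > 1" using assms by simp
  then show ?thesis
    using hardy2_phi1_iff_contact[OF assms] contact_order_less_iff[of "1 / (q - 1)"] False
    by (simp add: pos_less_divide_eq)
qed

end

section \<open>From the first variable to the second\<close>

lemma torus_integral_swap:
  assumes "(\<lambda>x. f (r * cis (fst x)) (r * cis (snd x))) \<in> borel_measurable borel"
  shows "torus_integral q (\<lambda>a b. f b a) r = torus_integral q f r"
proof -
  define h where "h = (\<lambda>x. ennreal (norm (f (r * cis (fst x)) (r * cis (snd x))) powr q))"
  have [measurable]: "h \<in> borel_measurable borel" unfolding h_def using assms by measurable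
  have [measurable]: "(\<lambda>x. h (snd x, fst x)) \<in> borel_measurable borel"
  proof -
    have "h \<in> borel_measurable (borel \<Otimes>\<^sub>M borel)" by (simp add: borel_prod)
    then have "(\<lambda>x. h (snd x, fst x)) \<in> borel_measurable (borel \<Otimes>\<^sub>M borel)" by measurable
    then show ?thesis by (simp add: borel_prod)
  qed
  have "torus_integral q (\<lambda>a b. f b a) r = (\<integral>\<^sup>+x. h (snd x, fst x) * indicator ({0..2*pi} \<times> {0..2*pi}) x \<partial>lborel)"
    by (simp add: torus_integral_def h_def)
  also have "\<dots> = (\<integral>\<^sup>+x. h x * indicator ({0..2*pi} \<times> {0..2*pi}) x \<partial>lborel)"
    by (subst nn_integral_square(1), simp, subst nn_integral_square(2)) simp_all
  finally show ?thesis by (simp add: torus_integral_def h_def)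
qed

theorem theorem4p1:
  fixes p :: "complex poly poly" and i :: nat and q :: real
  assumes "\<forall>z1 z2. norm z1 < 1 \<and> norm z2 < 1 \<longrightarrow> eval2 p z1 z2 \<noteq> 0"
    and "coprime p (reflect2 p)"
    and "i \<in> {1, 2}"
    and "1 \<le> q"
  shows "hardy2 q (partial i (\<lambda>z1 z2. eval2 (reflect2 p) z1 z2 / eval2 p z1 z2))
         \<longleftrightarrow> (q = 1 \<or> contact_order i p < 1 / (q - 1))"
proof (cases "i = 1")
  case True
  interpret stable_poly p using assms by unfold_locales auto
  show ?thesis using hardy2_phi1_iff[OF assms(4)] True by simp
next
  case False
  then have i: "i = 2" using assms(3) by simp
  let ?f = "partial 2 (\<lambda>z1 z2. eval2 (reflect2 p) z1 z2 / eval2 p z1 z2)"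
  \<comment> \<open>Both hypotheses are symmetric in the variables, so the case i = 2 is the case i
    = 1 for \<open>swap2 p\<close>.\<close>
  interpret sw: stable_poly "swap2 p"
  proof
    show "eval2 (swap2 p) a b \<noteq> 0" if "norm a < 1" "norm b < 1" for a b
      using assms(1) that by simp
    show "coprime (swap2 p) (reflect2 (swap2 p))"
      using coprime_swap2[OF assms(2)] by (simp add: reflect2_swap2)
  qed
  have f: "?f = (\<lambda>a b. sw.phi1 b a)"
    by (intro ext) (simp add: partial_def reflect2_swap2)
  have "holo_bidisk ?f \<longleftrightarrow> holo_bidisk sw.phi1"
    unfolding f holo_bidisk_def by blast
  moreover have "torus_integral q ?f r = torus_integral q sw.phi1 r" if "r \<in> {0<..<1}" for r
  proof -
    have "sw.phi1 (r * cis s) (r * cis t) = sw.F (r * cis s) (r * cis t)" for s t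
      using that by (intro sw.partial_eq_F sw.no_zeros) (simp_all add: norm_mult)
    \<comment> \<open>Measurability comes from the explicit formula \<open>sw.F\<close>, with which
      the derivative agrees at radius r.\<close>
    moreover have "(\<lambda>x. sw.F (r * cis (fst x)) (r * cis (snd x))) \<in> borel_measurable borel"
      unfolding borel_prod[symmetric] by measurable
    ultimately show ?thesis unfolding f by (intro torus_integral_swap) (simp only:)
  qed
  ultimately have "hardy2 q ?f \<longleftrightarrow> hardy2 q sw.phi1"
    unfolding hardy2_iff_bounded by simp
  moreover have "contact_order 2 p = contact_order 1 (swap2 p)"
  proof -
    have "(\<lambda>a b. eval2 f b a) = eval2 (swap2 f)" for f by (intro ext) simp
    then show ?thesis by (simp add: contact_order_def reflect2_swap2)
  qed
  ultimately show ?thesis using sw.hardy2_phi1_iff[OF assms(4)] i by simp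
qed

end
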